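(* Let $\lambda=(\lambda_n)$ be a frequency with a decomposition $\lambda=(R,B)$ of natural type, $B=(b_j)$, such that $b_j>0$ for every $j$ and (if $B$ is infinite) $\lim_j b_j=\infty$. Then $\lambda$ is hypercontractive.
   Context: A frequency is a strictly increasing unbounded sequence $\lambda=(\lambda_n)_{n\ge 1}$ of non-negative real numbers. A finite or infinite sequence $B=(b_j)$ of real numbers is a basis for $\lambda$ if it is $\mathbb{Q}$-linearly independent and for each $n$ there is a finite sequence $(r_j^n)_j$ of rational numbers with $\lambda_n=\sum_j r_j^n b_j$; the matrix $R=(r_j^n)_{n,j}$ is then a Bohr matrix of $\lambda$ with respect to $B$, and one writes $\lambda=(R,B)$ and calls this a decomposition of $\lambda$. The decomposition is of natural type if every entry of $R$ lies in $\mathbb{N}_0=\{0,1,2,\dots\}$. A $\lambda$-Dirichlet series is a formal series $\sum a_n e^{-\lambda_n s}$, $a_n\in\mathbb{C}$. A $\lambda$-Dirichlet group is a pair $(G,\beta)$ with $G$ a compact abelian group and $\beta:(\mathbb{R},+)\to G$ a continuous homomorphism with dense range such that for each $n$ there is a (unique) character $h_{\lambda_n}\in\widehat G$ with $h_{\lambda_n}(\beta(t))=e^{-i\lambda_n t}$ for all $t\in\mathbb{R}$; such groups always exist (e.g. the Bohr compactification of $\mathbb{R}$). For $1\le p\le\infty$, $H_p^\lambda(G)$ is the closed subspace of $L_p(G)$ of all $f$ whose Fourier coefficients vanish at all characters outside $\{h_{\lambda_n}:n\in\mathbb{N}\}$. $\mathcal{H}_p(\lambda)$ is the Banach space of all $\lambda$-Dirichlet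 series $\sum a_n e^{-\lambda_n s}$ for which there is a (unique) $f\in H_p^\lambda(G)$ with $a_n=\widehat f(h_{\lambda_n})$ for all $n$, with norm $\|f\|_{L_p(G)}$ (independent of the choice of the $\lambda$-Dirichlet group). For $\sigma>0$ the translation operator is $\tau_\sigma\big(\sum a_n e^{-\lambda_n s}\big)=\sum a_n e^{-\lambda_n\sigma}e^{-\lambda_n s}$. The frequency $\lambda$ is hypercontractive if for every $\sigma>0$ the operator $\tau_\sigma:\mathcal{H}_p(\lambda)\to\mathcal{H}_q(\lambda)$ is (well defined and) bounded for every $1\le p\le q<\infty$. *)

theory Defs
  imports "HOL-Probability.Probability"
begin

section \<open>Frequencies and decompositions\<close>

text \<open>Sequences that are classically indexed by \<open>1, 2, \<dots>\<close> are indexed from \<open>0\<close> throughout.\<close>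

definition frequency :: "(nat \<Rightarrow> real) \<Rightarrow> bool" where
  "frequency \<Lambda> \<longleftrightarrow> strict_mono \<Lambda> \<and> (\<forall>n. 0 \<le> \<Lambda> n) \<and> \<not> bdd_above (range \<Lambda>)"

text \<open>
  A finite or infinite sequence \<open>B = (b\<^sub>j)\<close> is given by its length \<open>L\<close>, possibly \<open>\<infinity>\<close>, and a function
  \<open>b\<close> of which only the values \<open>b j\<close> with \<open>j < L\<close> matter.
\<close>

definition indices :: "enat \<Rightarrow> nat set" where
  "indices L = {j. enat j < L}"

text \<open>
  Linear independence over the rationals of the sequence, not merely of its range:
  hence the injectivity.
\<close>

definition Q_independent :: "enat \<Rightarrow> (nat \<Rightarrow> real) \<Rightarrow> bool" where
  "Q_independent L b \<longleftrightarrow>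
     inj_on b (indices L) \<and>
     module.independent (\<lambda>(r::rat) (x::real). of_rat r * x) (b ` indices L)"

text \<open>
  Each row \<open>R n\<close> of a Bohr matrix is a finite sequence of rationals, encoded as a finitely supported
  function vanishing outside the index set of the basis.
\<close>

definition decomposition ::
    "(nat \<Rightarrow> real) \<Rightarrow> (nat \<Rightarrow> nat \<Rightarrow> rat) \<Rightarrow> enat \<Rightarrow> (nat \<Rightarrow> real) \<Rightarrow> bool" where
  "decomposition \<Lambda> R L b \<longleftrightarrow>
     Q_independent L b \<and>
     (\<forall>n. finite {j. R n j \<noteq> 0} \<and> {j. R n j \<noteq> 0} \<subseteq> indices L \<and>
          \<Lambda> n = (\<Sum>j | R n j \<noteq> 0. of_rat (R n j) * b j))"

definition natural_type :: "(nat \<Rightarrow> nat \<Rightarrow> rat) \<Rightarrow> bool" where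
  "natural_type R \<longleftrightarrow> (\<forall>n j. R n j \<in> \<nat>)"


section \<open>Compact abelian groups\<close>

text \<open>
  A compact abelian group is a type of sort \<open>topological_ab_group_add\<close> and \<open>t2_space\<close> whose universe
  is compact; it is written additively.
\<close>

definition character :: "('g::{topological_ab_group_add, t2_space} \<Rightarrow> complex) \<Rightarrow> bool" where
  "character \<gamma> \<longleftrightarrow>
     continuous_on UNIV \<gamma> \<and> (\<forall>x y. \<gamma> (x + y) = \<gamma> x * \<gamma> y) \<and> (\<forall>x. norm (\<gamma> x) = 1)"

text \<open>
  The normalised Haar measure: the regular translation-invariant Borel probability measure. (For
  finite Borel measures on a compact Hausdorff space, inner regularity implies outer regularity.)
\<close>

definition haar_measure :: "'g::{topological_ab_group_add, t2_space} measure \<Rightarrow> bool" where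
  "haar_measure \<mu> \<longleftrightarrow>
     sets \<mu> = sets borel \<and>
     prob_space \<mu> \<and>
     (\<forall>a. distr \<mu> borel (\<lambda>x. a + x) = \<mu>) \<and>
     (\<forall>A\<in>sets borel. emeasure \<mu> A = (SUP K \<in> {K. K \<subseteq> A \<and> compact K}. emeasure \<mu> K))"

definition Lp :: "'g measure \<Rightarrow> real \<Rightarrow> ('g \<Rightarrow> complex) set" where
  "Lp \<mu> p = {f \<in> borel_measurable \<mu>. integrable \<mu> (\<lambda>x. norm (f x) powr p)}"

definition Lp_norm :: "'g measure \<Rightarrow> real \<Rightarrow> ('g \<Rightarrow> complex) \<Rightarrow> real" where
  "Lp_norm \<mu> p f = (\<integral>x. norm (f x) powr p \<partial>\<mu>) powr (1 / p)"

definition fourier_coeff :: "'g measure \<Rightarrow> ('g \<Rightarrow> complex) \<Rightarrow> ('g \<Rightarrow> complex) \<Rightarrow> complex" where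
  "fourier_coeff \<mu> f \<gamma> = (\<integral>x. f x * cnj (\<gamma> x) \<partial>\<mu>)"


section \<open>Dirichlet groups and Hardy spaces of Dirichlet series\<close>

definition dirichlet_group ::
    "(nat \<Rightarrow> real) \<Rightarrow> (real \<Rightarrow> 'g::{topological_ab_group_add, t2_space}) \<Rightarrow> bool" where
  "dirichlet_group \<Lambda> \<beta> \<longleftrightarrow>
     compact (UNIV :: 'g set) \<and>
     continuous_on UNIV \<beta> \<and> (\<forall>s t. \<beta> (s + t) = \<beta> s + \<beta> t) \<and> closure (range \<beta>) = UNIV \<and>
     (\<forall>n. \<exists>\<gamma>. character \<gamma> \<and> (\<forall>t. \<gamma> (\<beta> t) = exp (- \<i> * of_real (\<Lambda> n * t))))"

text \<open>
  The character \<open>h\<^sub>x\<close> extending \<open>t \<mapsto> exp (- i x t)\<close>; it is unique because \<open>\<beta>\<close> has dense range.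
\<close>

definition freq_char ::
    "(real \<Rightarrow> 'g::{topological_ab_group_add, t2_space}) \<Rightarrow> real \<Rightarrow> 'g \<Rightarrow> complex" where
  "freq_char \<beta> x = (THE \<gamma>. character \<gamma> \<and> (\<forall>t. \<gamma> (\<beta> t) = exp (- \<i> * of_real (x * t))))"

definition Hp_group ::
    "(nat \<Rightarrow> real) \<Rightarrow> (real \<Rightarrow> 'g::{topological_ab_group_add, t2_space}) \<Rightarrow> 'g measure \<Rightarrow> real
       \<Rightarrow> ('g \<Rightarrow> complex) set" where
  "Hp_group \<Lambda> \<beta> \<mu> p =
     {f \<in> Lp \<mu> p. \<forall>\<gamma>. character \<gamma> \<and> \<gamma> \<notin> range (\<lambda>n. freq_char \<beta> (\<Lambda> n)) \<longrightarrow>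
                      fourier_coeff \<mu> f \<gamma> = 0}"

text \<open>
  A formal Dirichlet series \<open>\<Sum> a\<^sub>n exp (- \<Lambda>\<^sub>n s)\<close> is identified with its coefficient sequence \<open>a\<close>.
  The functions in \<open>Hp_group\<close> representing a given series.
\<close>

definition representers ::
    "(nat \<Rightarrow> real) \<Rightarrow> (real \<Rightarrow> 'g::{topological_ab_group_add, t2_space}) \<Rightarrow> 'g measure \<Rightarrow> real
       \<Rightarrow> (nat \<Rightarrow> complex) \<Rightarrow> ('g \<Rightarrow> complex) set" where
  "representers \<Lambda> \<beta> \<mu> p a =
     {f \<in> Hp_group \<Lambda> \<beta> \<mu> p. \<forall>n. a n = fourier_coeff \<mu> f (freq_char \<beta> (\<Lambda> n))}"

definition Hp ::
    "(nat \<Rightarrow> real) \<Rightarrow> (real \<Rightarrow> 'g::{topological_ab_group_add, t2_space}) \<Rightarrow> 'g measure \<Rightarrow> real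
       \<Rightarrow> (nat \<Rightarrow> complex) set" where
  "Hp \<Lambda> \<beta> \<mu> p = {a. representers \<Lambda> \<beta> \<mu> p a \<noteq> {}}"

text \<open>
  The norm of a series is the \<open>L\<^sub>p\<close> norm of the function representing it. That function is unique
  only up to null sets, so the infimum ranges over many functions but over a single value.
\<close>

definition Hp_norm ::
    "(nat \<Rightarrow> real) \<Rightarrow> (real \<Rightarrow> 'g::{topological_ab_group_add, t2_space}) \<Rightarrow> 'g measure \<Rightarrow> real
       \<Rightarrow> (nat \<Rightarrow> complex) \<Rightarrow> real" where
  "Hp_norm \<Lambda> \<beta> \<mu> p a = (INF f \<in> representers \<Lambda> \<beta> \<mu> p a. Lp_norm \<mu> p f)"

definition translation :: "(nat \<Rightarrow> real) \<Rightarrow> real \<Rightarrow> (nat \<Rightarrow> complex) \<Rightarrow> nat \<Rightarrow> complex" where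
  "translation \<Lambda> \<sigma> a = (\<lambda>n. a n * of_real (exp (- \<Lambda> n * \<sigma>)))"

text \<open>
  The spaces \<open>Hp\<close>, with their norms, do not depend on the choice of the Dirichlet group; here they
  are formed over the group and Haar measure given by \<open>\<beta>\<close> and \<open>\<mu>\<close>.
\<close>

definition hypercontractive ::
    "(real \<Rightarrow> 'g::{topological_ab_group_add, t2_space}) \<Rightarrow> 'g measure \<Rightarrow> (nat \<Rightarrow> real) \<Rightarrow> bool" where
  "hypercontractive \<beta> \<mu> \<Lambda> \<longleftrightarrow>
     (\<forall>\<sigma>>0. \<forall>p q. 1 \<le> p \<and> p \<le> q \<longrightarrow>
        translation \<Lambda> \<sigma> ` Hp \<Lambda> \<beta> \<mu> p \<subseteq> Hp \<Lambda> \<beta> \<mu> q \<and>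
        (\<exists>C. \<forall>a\<in>Hp \<Lambda> \<beta> \<mu> p.
           Hp_norm \<Lambda> \<beta> \<mu> q (translation \<Lambda> \<sigma> a) \<le> C * Hp_norm \<Lambda> \<beta> \<mu> p a))"

end

theory Submission
  imports Defs
begin

text \<open>
  A translation damps the frequency \<open>x\<close> by \<open>exp (- \<sigma> x)\<close>. It is therefore bounded from \<open>L\<^sub>1\<close> to \<open>L\<^sub>q\<close>
  for every finite \<open>q\<close> as soon as, for functions whose frequencies are at most \<open>T\<close>, the \<open>L\<^sub>q\<close> norm
  exceeds the \<open>L\<^sub>1\<close> norm by a factor that grows more slowly in \<open>T\<close> than every exponential.

  The source of this slow growth is arithmetic. All frequencies lie in the cone of combinations
  \<open>z = (\<Sum>j. \<gamma>\<^sub>j b\<^sub>j)\<close> with natural coefficients. By rational independence, \<open>z\<close> determines \<open>\<gamma>\<close>, and writing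
  \<open>z = x + y\<close> inside the cone means splitting \<open>\<gamma>\<close>, which can be done in \<open>\<Prod>j. (\<gamma>\<^sub>j + 1)\<close> ways. As soon as
  \<open>\<sigma> b\<^sub>j \<ge> 1\<close>, the factor \<open>\<gamma>\<^sub>j + 1\<close> is at most \<open>exp (\<sigma> \<gamma>\<^sub>j b\<^sub>j)\<close>; only finitely many \<open>j\<close> fail this, and each of
  them costs a constant factor. So there are at most \<open>C exp (\<sigma> z)\<close> representations, for every \<open>\<sigma> > 0\<close>
  (\<open>representation_count_subexponential\<close>).

  Parseval's identity and the Cauchy-Schwarz inequality turn the count into the estimate
  \<open>\<parallel>f\<parallel>\<^sub>4\<^sup>4 = \<parallel>f\<^sup>2\<parallel>\<^sub>2\<^sup>2 \<le> C exp (\<sigma> T) \<parallel>f\<parallel>\<^sub>2\<^sup>4\<close>. Repeated squaring of \<open>f\<close> extends it to all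
  exponents \<open>2\<^sup>k\<close> (\<open>low_polys_even_moment\<close>). It also compares \<open>L\<^sub>2\<close> with \<open>L\<^sub>1\<close>, since the \<open>L\<^sub>2\<close> norm
  interpolates between \<open>L\<^sub>1\<close> and \<open>L\<^sub>4\<close>: a function whose \<open>L\<^sub>4\<close> norm is controlled by its \<open>L\<^sub>2\<close> norm cannot
  have a small \<open>L\<^sub>1\<close> norm (\<open>low_polys_second_moment\<close>).

  A general element of the Hardy space has unbounded frequencies. It is cut into pieces \<open>f\<^sub>k\<close> with
  frequencies near \<open>k\<close> by tents of half-width one, which form a partition of unity. A tent is the Fourier
  transform of a positive kernel on the line, the Fejer kernel, so cutting averages translates along
  the dense line \<open>\<beta>\<close> and cannot increase the \<open>L\<^sub>1\<close> norm (\<open>window_L1_contraction\<close>). By the moment estimates the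
  translated pieces then decay geometrically in \<open>L\<^sub>q\<close>, and their sum represents the translated series
  (\<open>translation_representer\<close>).
\<close>


section \<open>Representations in the cone spanned by the basis\<close>

definition expansion :: "(nat \<Rightarrow> real) \<Rightarrow> (nat \<Rightarrow> nat) \<Rightarrow> real" where
  "expansion b \<alpha> = (\<Sum>j | \<alpha> j \<noteq> 0. real (\<alpha> j) * b j)"

definition multi_indices :: "nat set \<Rightarrow> (nat \<Rightarrow> nat) set" where
  "multi_indices J = {\<alpha>. finite {j. \<alpha> j \<noteq> 0} \<and> {j. \<alpha> j \<noteq> 0} \<subseteq> J}"

definition nat_cone :: "nat set \<Rightarrow> (nat \<Rightarrow> real) \<Rightarrow> real set" where
  "nat_cone J b = expansion b ` multi_indices J"

lemma expansion_eq_sum: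
  assumes "finite D" "{j. \<alpha> j \<noteq> 0} \<subseteq> D"
  shows "expansion b \<alpha> = (\<Sum>j\<in>D. real (\<alpha> j) * b j)"
  unfolding expansion_def by (rule sum.mono_neutral_left) (use assms in auto)

lemma multi_indices_add:
  assumes "\<alpha> \<in> multi_indices J" "\<alpha>' \<in> multi_indices J"
  shows "(\<lambda>j. \<alpha> j + \<alpha>' j) \<in> multi_indices J"
    and "expansion b (\<lambda>j. \<alpha> j + \<alpha>' j) = expansion b \<alpha> + expansion b \<alpha>'"
proof -
  let ?D = "{j. \<alpha> j \<noteq> 0} \<union> {j. \<alpha>' j \<noteq> 0}"
  have fin: "finite ?D" and sub: "?D \<subseteq> J" and eq: "{j. \<alpha> j + \<alpha>' j \<noteq> 0} = ?D"
    using assms by (auto simp: multi_indices_def)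
  show "(\<lambda>j. \<alpha> j + \<alpha>' j) \<in> multi_indices J"
    unfolding multi_indices_def mem_Collect_eq eq using fin sub by blast
  have "expansion b (\<lambda>j. \<alpha> j + \<alpha>' j) = (\<Sum>j\<in>?D. real (\<alpha> j + \<alpha>' j) * b j)"
    by (rule expansion_eq_sum[OF fin]) auto
  also have "\<dots> = (\<Sum>j\<in>?D. real (\<alpha> j) * b j) + (\<Sum>j\<in>?D. real (\<alpha>' j) * b j)"
    by (simp add: distrib_right sum.distrib)
  also have "\<dots> = expansion b \<alpha> + expansion b \<alpha>'"
    by (simp add: expansion_eq_sum[OF fin])
  finally show "expansion b (\<lambda>j. \<alpha> j + \<alpha>' j) = expansion b \<alpha> + expansion b \<alpha>'" .
qed

lemma nat_cone_add: "x \<in> nat_cone J b \<Longrightarrow> y \<in> nat_cone J b \<Longrightarrow> x + y \<in> nat_cone J b"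
proof -
  assume "x \<in> nat_cone J b" "y \<in> nat_cone J b"
  then obtain \<alpha> \<alpha>' where "\<alpha> \<in> multi_indices J" "x = expansion b \<alpha>"
    "\<alpha>' \<in> multi_indices J" "y = expansion b \<alpha>'" by (auto simp: nat_cone_def)
  then have "x + y = expansion b (\<lambda>j. \<alpha> j + \<alpha>' j)" "(\<lambda>j. \<alpha> j + \<alpha>' j) \<in> multi_indices J"
    by (simp_all add: multi_indices_add)
  then show ?thesis unfolding nat_cone_def by (rule image_eqI)
qed

lemma nat_cone_nonneg:
  assumes "\<And>j. j \<in> J \<Longrightarrow> 0 < b j" "x \<in> nat_cone J b"
  shows "0 \<le> x"
proof -
  obtain \<alpha> where "\<alpha> \<in> multi_indices J" "x = expansion b \<alpha>"
    using assms(2) by (auto simp: nat_cone_def)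
  moreover from this have "0 \<le> real (\<alpha> j) * b j" if "\<alpha> j \<noteq> 0" for j
    using that assms(1)[of j] by (auto simp: multi_indices_def)
  ultimately show ?thesis by (auto simp: expansion_def intro: sum_nonneg)
qed

lemma decomposition_in_nat_cone:
  assumes "decomposition \<Lambda> R L b" "natural_type R"
  shows "\<Lambda> n \<in> nat_cone (indices L) b"
proof -
  have "\<forall>j. \<exists>k::nat. R n j = of_nat k"
    using assms(2) unfolding natural_type_def by (metis Nats_cases)
  then obtain \<alpha> :: "nat \<Rightarrow> nat" where \<alpha>: "\<And>j. R n j = of_nat (\<alpha> j)" by metis
  have dec: "finite {j. R n j \<noteq> 0}" "{j. R n j \<noteq> 0} \<subseteq> indices L"
    "\<Lambda> n = (\<Sum>j | R n j \<noteq> 0. of_rat (R n j) * b j)"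
    using assms(1) unfolding decomposition_def by blast+
  have supp: "{j. \<alpha> j \<noteq> 0} = {j. R n j \<noteq> 0}" by (simp add: \<alpha>)
  have "\<alpha> \<in> multi_indices (indices L)" "\<Lambda> n = expansion b \<alpha>"
    unfolding multi_indices_def expansion_def mem_Collect_eq supp using dec by (simp_all add: \<alpha>)
  then show ?thesis unfolding nat_cone_def by (metis image_eqI)
qed

text \<open>
  Two expansions of one real number differ by a vanishing rational combination of the basis. Since
  \<open>b\<close> is injective on the indices, its coefficients can be carried over to the basis elements.
\<close>
lemma expansion_inj:
  assumes ind: "Q_independent L b" and \<alpha>: "\<alpha> \<in> multi_indices (indices L)"
    and \<alpha>': "\<alpha>' \<in> multi_indices (indices L)" and eq: "expansion b \<alpha> = expansion b \<alpha>'"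
  shows "\<alpha> = \<alpha>'"
proof -
  let ?D = "{j. \<alpha> j \<noteq> 0} \<union> {j. \<alpha>' j \<noteq> 0}"
  have fin: "finite ?D" and sub: "?D \<subseteq> indices L"
    using \<alpha> \<alpha>' by (auto simp: multi_indices_def)
  interpret vs: vector_space "\<lambda>(r::rat) (x::real). of_rat r * x"
    by unfold_locales (auto simp: algebra_simps of_rat_add of_rat_mult)
  have inj: "inj_on b ?D" and indep: "vs.independent (b ` indices L)"
    using ind inj_on_subset[OF _ sub] unfolding Q_independent_def by blast+
  define u :: "real \<Rightarrow> rat" where
    "u v = of_nat (\<alpha> (the_inv_into ?D b v)) - of_nat (\<alpha>' (the_inv_into ?D b v))" for v
  have u: "u (b j) = of_nat (\<alpha> j) - of_nat (\<alpha>' j)" if "j \<in> ?D" for j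
    using the_inv_into_f_f[OF inj that] by (simp add: u_def)
  have "(\<Sum>v\<in>b ` ?D. of_rat (u v) * v) = (\<Sum>j\<in>?D. (real (\<alpha> j) - real (\<alpha>' j)) * b j)"
    by (subst sum.reindex[OF inj]) (auto simp: u of_rat_diff intro!: sum.cong)
  also have "\<dots> = expansion b \<alpha> - expansion b \<alpha>'"
    by (simp add: left_diff_distrib sum_subtractf expansion_eq_sum[OF fin])
  finally have 0: "(\<Sum>v\<in>b ` ?D. of_rat (u v) * v) = 0" using eq by simp
  have "u (b j) = 0" if "j \<in> ?D" for j
    by (rule vs.independentD[OF indep _ _ 0]) (use fin sub that in auto)
  then have "\<alpha> j = \<alpha>' j" if "j \<in> ?D" for j using u[OF that] that by force
  moreover have "\<alpha> j = \<alpha>' j" if "j \<notin> ?D" for j using that by simp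
  ultimately show ?thesis by (intro ext) blast
qed

text \<open>
  The bound on a single factor of the count below; for \<open>s \<ge> 1\<close> its constant is \<open>1\<close>, which is what
  allows infinitely many factors.
\<close>
lemma Suc_le_const_exp:
  fixes s :: real
  assumes "0 < s"
  shows "real (k + 1) \<le> max 1 (1 / s) * exp (s * real k)"
proof -
  have "real k \<le> max 1 (1 / s) * (s * real k)"
    using assms mult_right_mono[of "1 / s" "max 1 (1 / s)" "s * real k"] by simp
  then have "real (k + 1) \<le> max 1 (1 / s) * (1 + s * real k)" by (simp add: distrib_left)
  also have "\<dots> \<le> max 1 (1 / s) * exp (s * real k)"
    by (intro mult_left_mono exp_ge_add_one_self) auto
  finally show ?thesis .
qed

text \<open>
  If \<open>z\<close> has the exponents \<open>\<gamma>\<close>, the exponents of a summand \<open>x\<close> of \<open>z = x + y\<close> are dominated by \<open>\<gamma>\<close>, so that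
  there are at most \<open>\<Prod>j. (\<gamma>\<^sub>j + 1)\<close> representations. The constant is the product of the finitely many
  single-factor constants that exceed \<open>1\<close>; it depends neither on \<open>z\<close> nor on the finite set \<open>X\<close>.
\<close>
lemma representation_count_subexponential:
  assumes ind: "Q_independent L b" and pos: "\<And>j. j \<in> indices L \<Longrightarrow> 0 < b j"
    and proper: "\<And>K. finite {j \<in> indices L. b j < K}" and \<sigma>: "0 < \<sigma>"
  shows "\<exists>C>0. \<forall>X z. finite X \<longrightarrow> X \<subseteq> nat_cone (indices L) b \<longrightarrow>
           real (card {x \<in> X. z - x \<in> X}) \<le> C * exp (\<sigma> * z)"
proof -
  define J where "J = indices L"
  define K where "K j = max 1 (1 / (\<sigma> * b j))" for j
  define E where "E = {j \<in> J. b j < 1 / \<sigma>}"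
  define C where "C = (\<Prod>j\<in>E. K j)"
  have K1: "1 \<le> K j" for j by (simp add: K_def)
  have finE: "finite E" using proper by (simp add: E_def J_def)
  have Kout: "K j = 1" if "j \<in> J" "j \<notin> E" for j
    using that pos[of j] \<sigma> by (auto simp: K_def E_def J_def field_simps)
  have C: "C > 0" unfolding C_def using less_le_trans[OF zero_less_one K1] by (intro prod_pos)
  have "real (card {x \<in> X. z - x \<in> X}) \<le> C * exp (\<sigma> * z)"
    if X: "finite X" "X \<subseteq> nat_cone J b" for X z
  proof (cases "{x \<in> X. z - x \<in> X} = {}")
    case True
    then show ?thesis unfolding True using C by simp
  next
    case False
    then obtain x0 where "x0 \<in> nat_cone J b" "z - x0 \<in> nat_cone J b" using X by blast
    from nat_cone_add[OF this] have "z \<in> nat_cone J b" by simp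
    then obtain \<gamma> where \<gamma>: "\<gamma> \<in> multi_indices J" "z = expansion b \<gamma>" by (auto simp: nat_cone_def)
    define D where "D = {j. \<gamma> j \<noteq> 0}"
    have D: "finite D" "D \<subseteq> J" using \<gamma> by (auto simp: D_def multi_indices_def)
    have "\<exists>\<alpha>. x = expansion b \<alpha> \<and> \<alpha> \<in> multi_indices J \<and> (\<forall>j. \<alpha> j \<le> \<gamma> j)"
      if x: "x \<in> {x \<in> X. z - x \<in> X}" for x
    proof -
      obtain \<alpha> \<alpha>' where \<alpha>: "\<alpha> \<in> multi_indices J" "x = expansion b \<alpha>"
        and \<alpha>': "\<alpha>' \<in> multi_indices J" "z - x = expansion b \<alpha>'"
      proof -
        have "x \<in> nat_cone J b" "z - x \<in> nat_cone J b" using x X by blast+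
        then show ?thesis unfolding nat_cone_def by (elim imageE) (rule that)
      qed
      have "expansion b (\<lambda>j. \<alpha> j + \<alpha>' j) = expansion b \<gamma>"
        using multi_indices_add(2)[OF \<alpha>(1) \<alpha>'(1)] \<alpha> \<alpha>' \<gamma> by simp
      then have "(\<lambda>j. \<alpha> j + \<alpha>' j) = \<gamma>"
        using multi_indices_add(1)[OF \<alpha>(1) \<alpha>'(1)] \<gamma>(1) unfolding J_def
        by (intro expansion_inj[OF ind])
      then have "\<forall>j. \<alpha> j \<le> \<gamma> j" by auto
      then show ?thesis using \<alpha> by blast
    qed
    then obtain A where A: "\<And>x. x \<in> {x \<in> X. z - x \<in> X} \<Longrightarrow>
        x = expansion b (A x) \<and> A x \<in> multi_indices J \<and> (\<forall>j. A x j \<le> \<gamma> j)" by metis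
    have supp: "{j. A x j \<noteq> 0} \<subseteq> D" if "x \<in> {x \<in> X. z - x \<in> X}" for x
      using A[OF that] unfolding D_def by (metis (mono_tags, lifting) Collect_mono le_zero_eq)
    have "card {x \<in> X. z - x \<in> X} \<le> card (PiE D (\<lambda>j. {..\<gamma> j}))"
    proof (rule card_inj_on_le[where f = "\<lambda>x. restrict (A x) D"])
      show "inj_on (\<lambda>x. restrict (A x) D) {x \<in> X. z - x \<in> X}"
      proof (rule inj_onI)
        fix x y assume xy: "x \<in> {x \<in> X. z - x \<in> X}" "y \<in> {x \<in> X. z - x \<in> X}"
          and eq: "restrict (A x) D = restrict (A y) D"
        have "A x j = A y j" if "j \<in> D" for j using fun_cong[OF eq, of j] that by simp
        then have "expansion b (A x) = expansion b (A y)"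
          using supp[OF xy(1)] supp[OF xy(2)] by (simp add: expansion_eq_sum[OF D(1)])
        then show "x = y" using A[OF xy(1)] A[OF xy(2)] by metis
      qed
      show "(\<lambda>x. restrict (A x) D) ` {x \<in> X. z - x \<in> X} \<subseteq> PiE D (\<lambda>j. {..\<gamma> j})"
        using A unfolding image_subset_iff restrict_PiE_iff atMost_iff by blast
    qed (simp add: finite_PiE D(1))
    also have "\<dots> = (\<Prod>j\<in>D. \<gamma> j + 1)" by (simp add: card_PiE[OF D(1)])
    finally have "real (card {x \<in> X. z - x \<in> X}) \<le> real (\<Prod>j\<in>D. \<gamma> j + 1)"
      by (rule of_nat_mono)
    also have "\<dots> = (\<Prod>j\<in>D. real (\<gamma> j + 1))" by (rule of_nat_prod)
    also have "\<dots> \<le> (\<Prod>j\<in>D. K j * exp (\<sigma> * b j * real (\<gamma> j)))"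
    proof (rule prod_mono)
      fix j assume "j \<in> D"
      then have "0 < \<sigma> * b j" using D pos \<sigma> by (auto simp: J_def)
      then show "0 \<le> real (\<gamma> j + 1) \<and> real (\<gamma> j + 1) \<le> K j * exp (\<sigma> * b j * real (\<gamma> j))"
        unfolding K_def using Suc_le_const_exp by simp
    qed
    also have "\<dots> = (\<Prod>j\<in>D. K j) * exp (\<sigma> * z)"
      using D unfolding \<gamma>(2) expansion_def D_def[symmetric]
      by (simp add: prod.distrib exp_sum sum_distrib_left mult_ac)
    \<comment> \<open>Outside \<open>E\<close> the constants \<open>K j\<close> are \<open>1\<close>, so that the support of \<open>\<gamma>\<close> drops out of the bound.\<close>
    also have "(\<Prod>j\<in>D. K j) = (\<Prod>j\<in>D \<inter> E. K j)"
      by (rule prod.mono_neutral_right) (use D Kout in auto)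
    also have "\<dots> \<le> C"
      unfolding C_def by (rule prod_mono2) (use finE K1 order_trans[OF zero_le_one K1] in auto)
    finally show ?thesis by simp
  qed
  then show ?thesis using C unfolding J_def by blast
qed

lemma basis_proper:
  fixes b :: "nat \<Rightarrow> real"
  assumes "L = \<infinity> \<Longrightarrow> filterlim b at_top sequentially"
  shows "finite {j \<in> indices L. b j < K}"
proof (cases L)
  case (enat n)
  have "indices L \<subseteq> {..<n}" by (auto simp: enat indices_def)
  then have "{j \<in> indices L. b j < K} \<subseteq> {..<n}" by blast
  then show ?thesis by (rule finite_subset) simp
next
  case infinity
  have "eventually (\<lambda>j. K \<le> b j) sequentially"
    using assms[OF infinity] filterlim_at_top[of b sequentially] by simp
  then obtain N where N: "\<And>j. N \<le> j \<Longrightarrow> K \<le> b j"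
    unfolding eventually_sequentially by blast
  have "j < N" if "b j < K" for j using N[of j] that by linarith
  then have "{j \<in> indices L. b j < K} \<subseteq> {..<N}" by blast
  then show ?thesis by (rule finite_subset) simp
qed

text \<open>
  The arithmetic input for the analysis on the group: sums of two elements of the semigroup represent
  each real number \<open>z\<close> in a number of ways that is subexponential in \<open>z\<close>. The finite sets \<open>X\<close> will be
  spectra of trigonometric sums; the constant is uniform in them.
\<close>
definition thin_semigroup :: "real set \<Rightarrow> bool" where
  "thin_semigroup K \<longleftrightarrow> K \<subseteq> {0..} \<and> (\<forall>x\<in>K. \<forall>y\<in>K. x + y \<in> K) \<and>
     (\<forall>\<sigma>>0. \<exists>C>0. \<forall>X z. finite X \<longrightarrow> X \<subseteq> K \<longrightarrow>
        real (card {x \<in> X. z - x \<in> X}) \<le> C * exp (\<sigma> * z))"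

lemma thin_nat_cone:
  assumes "Q_independent L b" and pos: "\<And>j. j \<in> indices L \<Longrightarrow> 0 < b j"
    and "L = \<infinity> \<Longrightarrow> filterlim b at_top sequentially"
  shows "thin_semigroup (nat_cone (indices L) b)"
  unfolding thin_semigroup_def
  using nat_cone_nonneg[of "indices L" b] nat_cone_add[of _ "indices L" b] pos
    representation_count_subexponential[OF assms(1) pos basis_proper[OF assms(3)]]
  by (auto simp: subset_iff)

section \<open>The Fejer kernel on the line\<close>

definition tent :: "real \<Rightarrow> real" where
  "tent s = max 0 (1 - \<bar>s\<bar>)"

definition fejer :: "real \<Rightarrow> real" where
  "fejer t = (1 - cos t) / t\<^sup>2"

lemma fejer_nonneg: "0 \<le> fejer t" by (simp add: fejer_def)

lemma fejer_measurable [measurable]: "fejer \<in> borel_measurable borel"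
  unfolding fejer_def by measurable

lemma one_minus_cos_le: "1 - cos t \<le> t\<^sup>2 / 2" for t :: real
proof -
  have "cos t = 1 - 2 * (sin (t / 2))\<^sup>2" using cos_double_sin[of "t / 2"] by simp
  moreover have "(sin (t / 2))\<^sup>2 \<le> (t / 2)\<^sup>2"
    using abs_sin_x_le_abs_x[of "t / 2"] by (simp only: abs_le_square_iff)
  ultimately show ?thesis by (simp add: power_divide)
qed

lemma fejer_integrable: "integrable lborel fejer"
proof (rule Bochner_Integration.integrable_bound)
  show "integrable lborel (\<lambda>t::real. 5 / 2 * inverse (1 + t\<^sup>2))"
    using integrable_inverse_1_plus_square by (simp add: set_integrable_def)
  show "AE t in lborel. norm (fejer t) \<le> norm (5 / 2 * inverse (1 + t\<^sup>2))"
  proof (intro AE_I2)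
    fix t :: real
    have pos: "0 < 1 + t\<^sup>2" by (simp add: add_pos_nonneg)
    have "fejer t \<le> 5 / 2 * inverse (1 + t\<^sup>2)"
    proof (cases "t = 0")
      case False
      have "(1 - cos t) * t\<^sup>2 \<le> 2 * t\<^sup>2" by (rule mult_right_mono) (use cos_ge_minus_one[of t] in auto)
      then have "(1 - cos t) * (1 + t\<^sup>2) \<le> 5 / 2 * t\<^sup>2"
        using one_minus_cos_le[of t] by (simp add: distrib_left)
      then show ?thesis using False pos by (simp add: fejer_def field_simps)
    qed (simp add: fejer_def)
    then show "norm (fejer t) \<le> norm (5 / 2 * inverse (1 + t\<^sup>2))"
      using fejer_nonneg[of t] pos by simp
  qed
qed simp

definition fejer_mass :: real where
  "fejer_mass = (\<integral>t. fejer t \<partial>lborel)"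

lemma fejer_mass_pos: "0 < fejer_mass"
proof -
  have c: "0 < 1 - cos (1::real)" using cos_monotone_0_pi[of 0 1] pi_gt3 by simp
  have "(1 - cos (1::real)) / 4 = (\<integral>t. (1 - cos 1) / 4 * indicator {1..2} (t::real) \<partial>lborel)" by simp
  also have "\<dots> \<le> fejer_mass" unfolding fejer_mass_def
  proof (rule integral_mono)
    show "integrable lborel (\<lambda>t. (1 - cos (1::real)) / 4 * indicator {1..2} (t::real))" by simp
    fix t :: real
    show "(1 - cos (1::real)) / 4 * indicator {1..2} t \<le> fejer t"
    proof (cases "t \<in> {1..2}")
      case True
      have "cos t \<le> cos 1" using True pi_gt3 by (intro cos_monotone_0_pi_le) auto
      moreover have "t\<^sup>2 \<le> 4" using True abs_le_square_iff[of t 2] by simp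
      moreover have "0 < t\<^sup>2" using True by simp
      ultimately have "(1 - cos 1) / 4 \<le> (1 - cos t) / t\<^sup>2" using c by (intro frac_le) auto
      then show ?thesis using True by (simp add: fejer_def)
    qed (simp add: fejer_nonneg)
  qed (rule fejer_integrable)
  finally show ?thesis using c by simp
qed

text \<open>
  Substituting \<open>a t\<close> for \<open>t\<close> in the Fejer kernel produces the kink \<open>\<bar>a\<bar>\<close> from which the tent is assembled.
\<close>
lemma integral_one_minus_cos:
  "integrable lborel (\<lambda>t. (1 - cos (a * t)) / t\<^sup>2)"
  "(\<integral>t. (1 - cos (a * t)) / t\<^sup>2 \<partial>lborel) = \<bar>a\<bar> * fejer_mass"
proof -
  have eq: "(\<lambda>t. (1 - cos (a * t)) / t\<^sup>2) = (\<lambda>t. a\<^sup>2 * fejer (0 + a * t))"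
    by (cases "a = 0") (auto simp: fejer_def fun_eq_iff power_mult_distrib)
  show "integrable lborel (\<lambda>t. (1 - cos (a * t)) / t\<^sup>2)"
    unfolding eq
    using lborel_integrable_real_affine[OF fejer_integrable, of a 0]
    by (cases "a = 0") (auto simp del: add_0)
  show "(\<integral>t. (1 - cos (a * t)) / t\<^sup>2 \<partial>lborel) = \<bar>a\<bar> * fejer_mass"
  proof (cases "a = 0")
    case False
    then have "fejer_mass = \<bar>a\<bar> * (\<integral>t. fejer (0 + a * t) \<partial>lborel)"
      unfolding fejer_mass_def using lborel_integral_real_affine[of a fejer 0] by simp
    then have "\<bar>a\<bar> * fejer_mass = a\<^sup>2 * (\<integral>t. fejer (0 + a * t) \<partial>lborel)"
      by (metis abs_mult_self_eq mult.assoc power2_eq_square)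
    then show ?thesis unfolding eq by simp
  qed simp
qed

text \<open>
  By the addition theorem, \<open>(1 - cos t) cos (s t)\<close> is half the sum of \<open>1 - cos ((s + 1) t)\<close> and
  \<open>1 - cos ((s - 1) t)\<close>, less \<open>1 - cos (s t)\<close>. Scaling integrates each of the three, and
  \<open>(\<bar>s + 1\<bar> + \<bar>s - 1\<bar>) / 2 - \<bar>s\<bar>\<close> is the tent.
\<close>
lemma fejer_fourier:
  "integrable lborel (\<lambda>t. complex_of_real (fejer t) * cis (- (s * t)))"
  "(\<integral>t. complex_of_real (fejer t) * cis (- (s * t)) \<partial>lborel) = fejer_mass * tent s"
proof -
  let ?g = "\<lambda>a t::real. (1 - cos (a * t)) / t\<^sup>2"
  have cos_eq: "fejer t * cos (s * t) = (?g (s + 1) t + ?g (s - 1) t) / 2 - ?g s t" for t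
  proof -
    have "(1 - cos t) * cos (s * t)
        = ((1 - cos ((s + 1) * t)) + (1 - cos ((s - 1) * t))) / 2 - (1 - cos (s * t))"
      by (simp add: distrib_right left_diff_distrib cos_add cos_diff) (simp add: field_simps)
    then show ?thesis
      by (simp only: fejer_def times_divide_eq_left) (simp only: add_divide_distrib diff_divide_distrib
          divide_divide_eq_left mult.commute)
  qed
  have ci: "integrable lborel (\<lambda>t. fejer t * cos (s * t))"
    unfolding cos_eq by (intro Bochner_Integration.integrable_diff integrable_divide_zero
        Bochner_Integration.integrable_add integral_one_minus_cos impI)
  have "(\<integral>t. fejer t * cos (s * t) \<partial>lborel)
      = (\<bar>s + 1\<bar> * fejer_mass + \<bar>s - 1\<bar> * fejer_mass) / 2 - \<bar>s\<bar> * fejer_mass"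
    unfolding cos_eq by (simp add: integral_one_minus_cos)
  also have "\<dots> = fejer_mass * ((\<bar>s + 1\<bar> + \<bar>s - 1\<bar>) / 2 - \<bar>s\<bar>)"
    by (simp add: algebra_simps add_divide_distrib)
  also have "(\<bar>s + 1\<bar> + \<bar>s - 1\<bar>) / 2 - \<bar>s\<bar> = tent s"
    by (auto simp: tent_def max_def abs_if)
  finally have cint: "(\<integral>t. fejer t * cos (s * t) \<partial>lborel) = fejer_mass * tent s" .
  have si: "integrable lborel (\<lambda>t. fejer t * sin (s * t))"
  proof (rule Bochner_Integration.integrable_bound[OF fejer_integrable])
    show "AE t in lborel. norm (fejer t * sin (s * t)) \<le> norm (fejer t)"
      using fejer_nonneg by (auto simp: abs_mult intro!: mult_left_le)
  qed simp
  \<comment> \<open>The imaginary part is the integral of an odd function.\<close>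
  have "(\<integral>t. fejer t * sin (s * t) \<partial>lborel) = - (\<integral>t. fejer t * sin (s * t) \<partial>lborel)"
    using lborel_integral_real_affine[of "-1" "\<lambda>t. fejer t * sin (s * t)" 0]
    by (simp add: fejer_def)
  then have sint: "(\<integral>t. fejer t * sin (s * t) \<partial>lborel) = 0" by simp
  have eq: "(\<lambda>t. complex_of_real (fejer t) * cis (- (s * t)))
      = (\<lambda>t. complex_of_real (fejer t * cos (s * t)) - \<i> * complex_of_real (fejer t * sin (s * t)))"
    by (auto simp: fun_eq_iff complex_eq_iff)
  have ci': "integrable lborel (\<lambda>t. complex_of_real (fejer t * cos (s * t)))"
    and si': "integrable lborel (\<lambda>t. complex_of_real (fejer t * sin (s * t)))"
    using integrable_of_real[OF ci] integrable_of_real[OF si] by simp_all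
  show "integrable lborel (\<lambda>t. complex_of_real (fejer t) * cis (- (s * t)))"
    unfolding eq by (intro Bochner_Integration.integrable_diff integrable_mult_right ci' si')
  have "(\<integral>t. complex_of_real (fejer t) * cis (- (s * t)) \<partial>lborel)
     = (\<integral>t. complex_of_real (fejer t * cos (s * t)) \<partial>lborel)
       - (\<integral>t. \<i> * complex_of_real (fejer t * sin (s * t)) \<partial>lborel)"
    unfolding eq by (intro Bochner_Integration.integral_diff integrable_mult_right ci' si')
  also have "\<dots> = complex_of_real (fejer_mass * tent s) - \<i> * complex_of_real 0"
    unfolding integral_complex_of_real cint[symmetric] sint[symmetric] integral_mult_right_zero ..
  finally show "(\<integral>t. complex_of_real (fejer t) * cis (- (s * t)) \<partial>lborel) = fejer_mass * tent s"
    by simp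
qed

text \<open>
  Multiplying the coefficients of an almost periodic polynomial by a shifted tent and evaluating at \<open>0\<close>
  averages the polynomial, up to unimodular factors, against a probability density.
\<close>
lemma tent_multiplier_bound:
  fixes c :: "real \<Rightarrow> complex"
  assumes X: "finite X" and M: "\<And>t. norm (\<Sum>x\<in>X. c x * cis (- (x * t))) \<le> M"
  shows "norm (\<Sum>x\<in>X. c x * tent (x - k)) \<le> M"
proof -
  let ?h = "\<lambda>t. complex_of_real (fejer t) * cis (k * t) * (\<Sum>x\<in>X. c x * cis (- (x * t)))"
  have h: "?h t = (\<Sum>x\<in>X. c x * (complex_of_real (fejer t) * cis (- ((x - k) * t))))" for t
  proof -
    have "cis (- ((x - k) * t)) = cis (k * t) * cis (- (x * t))" for x
      by (simp add: cis_mult left_diff_distrib)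
    then show ?thesis by (simp add: sum_distrib_left mult_ac)
  qed
  have "(\<integral>t. ?h t \<partial>lborel) = (\<Sum>x\<in>X. c x * (fejer_mass * tent (x - k)))"
    unfolding h by (subst Bochner_Integration.integral_sum) (auto simp: fejer_fourier intro!: integrable_mult_right)
  also have "\<dots> = fejer_mass * (\<Sum>x\<in>X. c x * tent (x - k))"
    by (simp add: sum_distrib_left mult_ac)
  finally have "fejer_mass * norm (\<Sum>x\<in>X. c x * tent (x - k)) = norm (\<integral>t. ?h t \<partial>lborel)"
    using fejer_mass_pos by (simp add: norm_mult)
  also have "\<dots> \<le> (\<integral>t. fejer t * M \<partial>lborel)"
  proof (rule Bochner_Integration.integral_norm_bound_integral)
    show "integrable lborel ?h"
      unfolding h by (intro Bochner_Integration.integrable_sum integrable_mult_right fejer_fourier)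
    show "integrable lborel (\<lambda>t. fejer t * M)" using fejer_integrable by simp
    show "norm (?h t) \<le> fejer t * M" for t
      using M[of t] fejer_nonneg[of t] by (simp add: norm_mult mult_left_mono)
  qed
  also have "\<dots> = fejer_mass * M" by (simp add: fejer_mass_def)
  finally show ?thesis using fejer_mass_pos by simp
qed

lemma tent_partition_of_unity:
  assumes "0 \<le> x"
  shows "(\<lambda>k. tent (x - real k)) sums 1"
proof -
  define m where "m = nat \<lfloor>x\<rfloor>"
  have m: "real m \<le> x" "x < real m + 1" using assms by (simp_all add: m_def)
  have "(\<lambda>k. tent (x - real k)) sums (\<Sum>k\<in>{m, Suc m}. tent (x - real k))"
  proof (rule sums_finite)
    fix k assume "k \<notin> {m, Suc m}"
    then have "real k + 1 \<le> real m \<or> real m + 2 \<le> real k" by (simp, linarith)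
    then show "tent (x - real k) = 0" using m by (auto simp: tent_def)
  qed simp
  also have "(\<Sum>k\<in>{m, Suc m}. tent (x - real k)) = 1" using m by (simp add: tent_def)
  finally show ?thesis .
qed

section \<open>Characters and trigonometric sums on the group\<close>

text \<open>
  What the analysis uses of a Dirichlet group: its characters are determined by their values on the
  line \<open>\<beta>\<close>, and Haar measure makes distinct characters orthogonal.
\<close>
locale dirichlet_flow =
  fixes \<beta> :: "real \<Rightarrow> 'g::{topological_ab_group_add, t2_space}" and \<mu> :: "'g measure"
  assumes dense: "closure (range \<beta>) = UNIV"
    and haar: "haar_measure \<mu>"
begin

abbreviation h :: "real \<Rightarrow> 'g \<Rightarrow> complex" where
  "h \<equiv> freq_char \<beta>"

text \<open>
  Characters of the group are indexed by the real frequencies that they have along the line. A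
  trigonometric sum is then given by a finite set of reals, and multiplying characters adds frequencies.
\<close>
definition spectrum :: "real set" where
  "spectrum = {x. \<exists>\<gamma>. character \<gamma> \<and> (\<forall>t. \<gamma> (\<beta> t) = cis (- (x * t)))}"

lemma character_eqI:
  assumes "character \<gamma>" "character \<gamma>'" "\<And>t. \<gamma> (\<beta> t) = \<gamma>' (\<beta> t)"
  shows "\<gamma> = \<gamma>'"
proof -
  have "closed {u. \<gamma> u = \<gamma>' u}"
    using assms by (intro closed_Collect_eq) (auto simp: character_def)
  then have "closure (range \<beta>) \<subseteq> {u. \<gamma> u = \<gamma>' u}"
    using assms(3) by (intro closure_minimal) auto
  then show ?thesis using dense by auto
qed

lemma freq_char_eqI:
  assumes "character \<gamma>" "\<And>t. \<gamma> (\<beta> t) = cis (- (x * t))"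
  shows "x \<in> spectrum" "h x = \<gamma>"
proof -
  show "x \<in> spectrum" using assms by (auto simp: spectrum_def)
  show "h x = \<gamma>"
    unfolding freq_char_def
  proof (rule the_equality)
    show "character \<gamma> \<and> (\<forall>t. \<gamma> (\<beta> t) = exp (- \<i> * complex_of_real (x * t)))"
      using assms by (simp add: cis_conv_exp)
  next
    fix \<gamma>' assume "character \<gamma>' \<and> (\<forall>t. \<gamma>' (\<beta> t) = exp (- \<i> * complex_of_real (x * t)))"
    then show "\<gamma>' = \<gamma>" using assms by (intro character_eqI) (auto simp: cis_conv_exp)
  qed
qed

lemma freq_char:
  assumes "x \<in> spectrum"
  shows character_freq_char: "character (h x)" and freq_char_flow: "h x (\<beta> t) = cis (- (x * t))"
proof -
  obtain \<gamma> where \<gamma>: "character \<gamma>" "\<And>t. \<gamma> (\<beta> t) = cis (- (x * t))"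
    using assms by (auto simp: spectrum_def)
  then have "h x = \<gamma>" by (rule freq_char_eqI)
  then show "character (h x)" "h x (\<beta> t) = cis (- (x * t))" using \<gamma> by simp_all
qed

lemma freq_char_hom: "x \<in> spectrum \<Longrightarrow> h x (u + v) = h x u * h x v"
  using character_freq_char by (auto simp: character_def)

lemma norm_freq_char [simp]: "x \<in> spectrum \<Longrightarrow> norm (h x u) = 1"
  using character_freq_char by (auto simp: character_def)

lemma continuous_freq_char: "x \<in> spectrum \<Longrightarrow> continuous_on UNIV (h x)"
  using character_freq_char by (auto simp: character_def)

lemma spectrum_add:
  assumes "x \<in> spectrum" "y \<in> spectrum"
  shows "x + y \<in> spectrum" "h (x + y) = (\<lambda>u. h x u * h y u)"
proof -
  have "character (\<lambda>u. h x u * h y u)"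
    using assms by (auto simp: character_def freq_char_hom norm_mult
        intro!: continuous_intros continuous_freq_char)
  moreover have "h x (\<beta> t) * h y (\<beta> t) = cis (- ((x + y) * t))" for t
    using assms by (simp add: freq_char_flow cis_mult algebra_simps)
  ultimately show "x + y \<in> spectrum" "h (x + y) = (\<lambda>u. h x u * h y u)"
    by (rule freq_char_eqI)+
qed

lemma spectrum_uminus:
  assumes "x \<in> spectrum"
  shows "- x \<in> spectrum" "h (- x) = (\<lambda>u. cnj (h x u))"
proof -
  have "character (\<lambda>u. cnj (h x u))"
    using assms by (auto simp: character_def freq_char_hom
        intro!: continuous_intros continuous_freq_char)
  moreover have "cnj (h x (\<beta> t)) = cis (- ((- x) * t))" for t
    using assms by (simp add: freq_char_flow cis_cnj)
  ultimately show "- x \<in> spectrum" "h (- x) = (\<lambda>u. cnj (h x u))"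
    by (rule freq_char_eqI)+
qed

lemma spectrum_zero: "0 \<in> spectrum" "h 0 = (\<lambda>u. 1)"
  by (rule freq_char_eqI; simp add: character_def)+

text \<open>
  At the time \<open>t\<close> at which two different frequencies are in opposite phase, the characters differ.
\<close>
lemma freq_char_inj:
  assumes "x \<in> spectrum" "y \<in> spectrum" "h x = h y"
  shows "x = y"
proof (rule ccontr)
  assume "x \<noteq> y"
  define t where "t = pi / (x - y)"
  have "cis (- (x * t)) = cis (- (y * t))"
    using assms freq_char_flow by metis
  then have "cis (- (x * t)) * cis (x * t) = cis (- (y * t)) * cis (x * t)" by simp
  then have "1 = cis ((x - y) * t)" by (simp add: cis_mult left_diff_distrib)
  then show False using \<open>x \<noteq> y\<close> by (simp add: t_def)
qed

sublocale prob_space \<mu>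
  using haar by (simp add: haar_measure_def)

lemma sets_haar [measurable_cong, simp]: "sets \<mu> = sets borel"
  using haar by (simp add: haar_measure_def)

lemma space_haar [simp]: "space \<mu> = UNIV"
  using sets_eq_imp_space_eq[OF sets_haar] by simp

lemma prob_UNIV [simp]: "prob UNIV = 1"
  using prob_space by simp

lemma continuous_imp_measurable:
  "continuous_on UNIV f \<Longrightarrow> f \<in> borel_measurable \<mu>"
  using borel_measurable_continuous_onI measurable_cong_sets[OF sets_haar refl] by blast

lemma integrable_continuous_bounded:
  fixes f :: "'g \<Rightarrow> 'b::{banach, second_countable_topology}"
  assumes "continuous_on UNIV f" "\<And>u. norm (f u) \<le> B"
  shows "integrable \<mu> f"
  using assms by (intro integrable_const_bound[of _ B] continuous_imp_measurable) auto

text \<open>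
  Translation by a point where the character is not \<open>1\<close> multiplies the integral by a number
  different from \<open>1\<close>, but leaves it unchanged by invariance.
\<close>
lemma integral_character:
  assumes "character \<gamma>" "\<gamma> \<noteq> (\<lambda>u. 1)"
  shows "(\<integral>u. \<gamma> u \<partial>\<mu>) = 0"
proof -
  obtain a where a: "\<gamma> a \<noteq> 1" using assms(2) by auto
  have meas: "(\<lambda>u. a + u) \<in> measurable \<mu> borel"
    by (intro continuous_imp_measurable continuous_intros)
  have "\<gamma> \<in> borel_measurable borel"
    using assms(1) by (intro borel_measurable_continuous_onI) (simp add: character_def)
  then have "(\<integral>u. \<gamma> u \<partial>\<mu>) = (\<integral>u. \<gamma> (a + u) \<partial>\<mu>)"
    using integral_distr[OF meas, of \<gamma>] haar by (simp add: haar_measure_def)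
  also have "\<dots> = \<gamma> a * (\<integral>u. \<gamma> u \<partial>\<mu>)" using assms(1) by (simp add: character_def)
  finally show ?thesis using a by simp
qed

lemma character_orthogonal:
  assumes "character \<gamma>" "character \<gamma>'" "\<gamma> \<noteq> \<gamma>'"
  shows "(\<integral>u. \<gamma> u * cnj (\<gamma>' u) \<partial>\<mu>) = 0"
proof (rule integral_character)
  show "character (\<lambda>u. \<gamma> u * cnj (\<gamma>' u))"
    using assms by (auto simp: character_def norm_mult intro!: continuous_intros)
  obtain u where u: "\<gamma> u \<noteq> \<gamma>' u" using assms(3) by auto
  have "\<gamma>' u * cnj (\<gamma>' u) = 1"
    using assms(2) complex_norm_square[of "\<gamma>' u"] by (simp add: character_def)
  moreover from this have "cnj (\<gamma>' u) \<noteq> 0" by auto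
  ultimately have "\<gamma> u * cnj (\<gamma>' u) \<noteq> 1" using u by (metis mult_right_cancel)
  then show "(\<lambda>u. \<gamma> u * cnj (\<gamma>' u)) \<noteq> (\<lambda>u. 1)" by metis
qed

lemma character_self:
  assumes "character \<gamma>"
  shows "\<gamma> u * cnj (\<gamma> u) = 1"
  using assms complex_norm_square[of "\<gamma> u"] by (simp add: character_def)

lemma freq_char_orthonormal:
  assumes "x \<in> spectrum" "y \<in> spectrum"
  shows "(\<integral>u. h x u * cnj (h y u) \<partial>\<mu>) = (if x = y then 1 else 0)"
  using assms freq_char_inj[OF assms] character_orthogonal[of "h x" "h y"]
    character_freq_char[of x] character_freq_char[of y]
  by (auto simp: character_self)

definition trig_sum :: "real set \<Rightarrow> (real \<Rightarrow> complex) \<Rightarrow> 'g \<Rightarrow> complex" where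
  "trig_sum X c u = (\<Sum>x\<in>X. c x * h x u)"

definition trig_polys :: "real set \<Rightarrow> ('g \<Rightarrow> complex) set" where
  "trig_polys A = {f. \<exists>X c. finite X \<and> X \<subseteq> A \<and> f = trig_sum X c}"

lemma trig_sum_continuous: "X \<subseteq> spectrum \<Longrightarrow> continuous_on UNIV (trig_sum X c)"
  unfolding trig_sum_def by (intro continuous_intros continuous_freq_char) auto

lemma trig_sum_bound: "X \<subseteq> spectrum \<Longrightarrow> norm (trig_sum X c u) \<le> (\<Sum>x\<in>X. norm (c x))"
  unfolding trig_sum_def by (rule sum_norm_le) (auto simp: norm_mult)

lemma trig_sum_measurable: "X \<subseteq> spectrum \<Longrightarrow> trig_sum X c \<in> borel_measurable \<mu>"
  by (intro continuous_imp_measurable trig_sum_continuous)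

lemma trig_sum_integrable_power:
  assumes "X \<subseteq> spectrum"
  shows "integrable \<mu> (\<lambda>u. norm (trig_sum X c u) ^ k)"
proof (rule integrable_continuous_bounded)
  show "continuous_on UNIV (\<lambda>u. norm (trig_sum X c u) ^ k)"
    using assms by (intro continuous_intros trig_sum_continuous)
  show "norm (norm (trig_sum X c u) ^ k) \<le> (\<Sum>x\<in>X. norm (c x)) ^ k" for u
    using trig_sum_bound[OF assms] by (simp add: power_mono)
qed

lemma trig_sum_mult:
  assumes X: "finite X" "X \<subseteq> spectrum" and Y: "finite Y" "Y \<subseteq> spectrum"
  shows "trig_sum X c u * trig_sum Y d u =
    trig_sum ((\<lambda>(x, y). x + y) ` (X \<times> Y)) (\<lambda>z. \<Sum>(x, y) | (x, y) \<in> X \<times> Y \<and> x + y = z. c x * d y) u"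
proof -
  let ?s = "\<lambda>(x, y). x + y :: real"
  have "trig_sum X c u * trig_sum Y d u = (\<Sum>(x, y)\<in>X \<times> Y. c x * d y * h (x + y) u)"
    unfolding trig_sum_def sum_product sum.cartesian_product
  proof (rule sum.cong[OF refl], safe)
    fix x y assume "x \<in> X" "y \<in> Y"
    then have "x \<in> spectrum" "y \<in> spectrum" using X Y by auto
    then show "c x * h x u * (d y * h y u) = c x * d y * h (x + y) u"
      by (simp add: spectrum_add mult_ac)
  qed
  also have "\<dots> = (\<Sum>z\<in>?s ` (X \<times> Y). \<Sum>p | p \<in> X \<times> Y \<and> ?s p = z. (case p of (x, y) \<Rightarrow> c x * d y * h (x + y) u))"
    using X Y by (intro sum.image_gen) auto
  also have "\<dots> = (\<Sum>z\<in>?s ` (X \<times> Y). (\<Sum>(x, y) | (x, y) \<in> X \<times> Y \<and> x + y = z. c x * d y) * h z u)"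
    unfolding sum_distrib_right by (intro sum.cong refl) auto
  finally show ?thesis by (simp only: trig_sum_def)
qed

lemma trig_polys_mult:
  assumes "f \<in> trig_polys A" "g \<in> trig_polys B" "A \<subseteq> spectrum" "B \<subseteq> spectrum"
    and "\<And>x y. x \<in> A \<Longrightarrow> y \<in> B \<Longrightarrow> x + y \<in> C"
  shows "(\<lambda>u. f u * g u) \<in> trig_polys C"
proof -
  obtain X c Y d where X: "finite X" "X \<subseteq> A" "f = trig_sum X c" and Y: "finite Y" "Y \<subseteq> B" "g = trig_sum Y d"
    using assms(1,2) by (auto simp: trig_polys_def)
  have XY: "X \<subseteq> spectrum" "Y \<subseteq> spectrum" using X Y assms by auto
  show ?thesis
    unfolding trig_polys_def mem_Collect_eq X(3) Y(3) trig_sum_mult[OF X(1) XY(1) Y(1) XY(2)]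
    using X Y assms(5) by (intro exI conjI refl) auto
qed

lemma trig_polys_const: "(\<lambda>u. a) \<in> trig_polys spectrum"
  unfolding trig_polys_def
  by (rule CollectI, rule exI[of _ "{0}"], rule exI[of _ "\<lambda>_. a"])
     (simp add: trig_sum_def spectrum_zero fun_eq_iff)

lemma trig_polys_add:
  assumes "f \<in> trig_polys A" "g \<in> trig_polys A"
  shows "(\<lambda>u. f u + g u) \<in> trig_polys A"
proof -
  obtain X c Y d where X: "finite X" "X \<subseteq> A" "f = trig_sum X c" and Y: "finite Y" "Y \<subseteq> A" "g = trig_sum Y d"
    using assms(1,2) by (auto simp: trig_polys_def)
  have "f u = trig_sum (X \<union> Y) (\<lambda>x. if x \<in> X then c x else 0) u"
    "g u = trig_sum (X \<union> Y) (\<lambda>x. if x \<in> Y then d x else 0) u" for u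
    unfolding X(3) Y(3) trig_sum_def using X(1) Y(1)
    by (auto intro!: sum.mono_neutral_cong_left)
  then have "(\<lambda>u. f u + g u) =
      trig_sum (X \<union> Y) (\<lambda>x. (if x \<in> X then c x else 0) + (if x \<in> Y then d x else 0))"
    by (auto simp: fun_eq_iff trig_sum_def distrib_right sum.distrib)
  moreover have "finite (X \<union> Y)" "X \<union> Y \<subseteq> A" using X Y by auto
  ultimately show ?thesis unfolding trig_polys_def by blast
qed

lemma trig_polys_cnj:
  assumes "f \<in> trig_polys spectrum"
  shows "(\<lambda>u. cnj (f u)) \<in> trig_polys spectrum"
proof -
  obtain X c where X: "finite X" "X \<subseteq> spectrum" "f = trig_sum X c"
    using assms by (auto simp: trig_polys_def)
  have "cnj (f u) = trig_sum (uminus ` X) (\<lambda>x. cnj (c (- x))) u" for u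
    unfolding X(3) trig_sum_def using X(2)
    by (subst sum.reindex) (auto simp: spectrum_uminus intro!: sum.cong)
  moreover have "finite (uminus ` X)" "uminus ` X \<subseteq> spectrum" using X spectrum_uminus by auto
  ultimately show ?thesis unfolding trig_polys_def by blast
qed

lemma trig_sum_coefficient:
  assumes X: "finite X" "X \<subseteq> spectrum" and y: "y \<in> spectrum"
  shows "fourier_coeff \<mu> (trig_sum X c) (h y) = (if y \<in> X then c y else 0)"
proof -
  have int: "integrable \<mu> (\<lambda>u. c x * (h x u * cnj (h y u)))" if "x \<in> X" for x
  proof (intro integrable_mult_right integrable_continuous_bounded[where B = 1])
    show "continuous_on UNIV (\<lambda>u. h x u * cnj (h y u))"
      using X y that by (intro continuous_intros continuous_freq_char) auto
    show "norm (h x u * cnj (h y u)) \<le> 1" for u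
      using X(2) y that by (simp add: norm_mult subset_iff)
  qed
  have "fourier_coeff \<mu> (trig_sum X c) (h y) = (\<integral>u. (\<Sum>x\<in>X. c x * (h x u * cnj (h y u))) \<partial>\<mu>)"
    unfolding fourier_coeff_def trig_sum_def by (simp add: sum_distrib_right mult.assoc)
  also have "\<dots> = (\<Sum>x\<in>X. (if x = y then c x else 0))"
  proof (subst Bochner_Integration.integral_sum[OF int], simp, rule sum.cong[OF refl])
    fix x assume "x \<in> X"
    then have "x \<in> spectrum" using X by auto
    then show "(\<integral>u. c x * (h x u * cnj (h y u)) \<partial>\<mu>) = (if x = y then c x else 0)"
      using freq_char_orthonormal[OF _ y] by simp
  qed
  also have "\<dots> = (if y \<in> X then c y else 0)" using X(1) by (simp add: sum.delta')
  finally show ?thesis .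
qed

lemma parseval:
  assumes X: "finite X" "X \<subseteq> spectrum"
  shows "(\<integral>u. norm (trig_sum X c u) ^ 2 \<partial>\<mu>) = (\<Sum>x\<in>X. norm (c x) ^ 2)"
proof -
  have int: "integrable \<mu> (\<lambda>u. cnj (c x) * (trig_sum X c u * cnj (h x u)))" if "x \<in> X" for x
  proof (intro integrable_mult_right integrable_continuous_bounded)
    show "continuous_on UNIV (\<lambda>u. trig_sum X c u * cnj (h x u))"
      using X that by (intro continuous_intros continuous_freq_char trig_sum_continuous) auto
    show "norm (trig_sum X c u * cnj (h x u)) \<le> (\<Sum>x\<in>X. norm (c x))" for u
      using trig_sum_bound[OF X(2)] X(2) that by (simp add: norm_mult subset_iff)
  qed
  have "complex_of_real (\<integral>u. norm (trig_sum X c u) ^ 2 \<partial>\<mu>)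
      = (\<integral>u. trig_sum X c u * cnj (trig_sum X c u) \<partial>\<mu>)"
    unfolding complex_norm_square[symmetric] by (rule integral_complex_of_real[symmetric])
  also have "\<dots> = (\<integral>u. (\<Sum>x\<in>X. cnj (c x) * (trig_sum X c u * cnj (h x u))) \<partial>\<mu>)"
    by (subst (2) trig_sum_def) (simp add: sum_distrib_left mult_ac)
  also have "\<dots> = (\<Sum>x\<in>X. cnj (c x) * fourier_coeff \<mu> (trig_sum X c) (h x))"
    by (subst Bochner_Integration.integral_sum[OF int]) (simp_all add: fourier_coeff_def)
  also have "\<dots> = (\<Sum>x\<in>X. complex_of_real (norm (c x) ^ 2))"
  proof (rule sum.cong[OF refl])
    fix x assume "x \<in> X"
    then have "fourier_coeff \<mu> (trig_sum X c) (h x) = c x"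
      using X by (subst trig_sum_coefficient) auto
    then show "cnj (c x) * fourier_coeff \<mu> (trig_sum X c) (h x) = complex_of_real (norm (c x) ^ 2)"
      unfolding complex_norm_square by (simp only: mult.commute)
  qed
  also have "\<dots> = complex_of_real (\<Sum>x\<in>X. norm (c x) ^ 2)" by simp
  finally show ?thesis by (simp only: of_real_eq_iff)
qed

end

section \<open>Moments of functions with low frequencies\<close>

text \<open>
  This is the log-convexity of the norms, \<open>(\<integral>f\<^sup>2)\<^sup>3 \<le> (\<integral>f)\<^sup>2 (\<integral>f\<^sup>4)\<close>, combined with the hypothesis. It follows
  from the pointwise inequality \<open>3 v \<le> 2 + v\<^sup>3\<close> for \<open>v = f / a\<close>, where the scale \<open>a\<close> is chosen such that
  the fourth moment contributes exactly one third of the bound and can be absorbed.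
\<close>
lemma second_moment_le_first:
  fixes f :: "'a \<Rightarrow> real"
  assumes f: "\<And>u. 0 \<le> f u"
    and int: "integrable M f" "integrable M (\<lambda>u. f u ^ 2)" "integrable M (\<lambda>u. f u ^ 4)"
    and D: "0 < D" and le: "(\<integral>u. f u ^ 4 \<partial>M) \<le> D * (\<integral>u. f u ^ 2 \<partial>M)\<^sup>2"
  shows "(\<integral>u. f u ^ 2 \<partial>M) \<le> D * (\<integral>u. f u \<partial>M)\<^sup>2"
proof (cases "(\<integral>u. f u ^ 2 \<partial>M) = 0")
  case True
  then show ?thesis using D by simp
next
  case False
  define B where "B = (\<integral>u. f u ^ 2 \<partial>M)"
  define B1 where "B1 = (\<integral>u. f u \<partial>M)"
  have "0 \<le> B" unfolding B_def by (rule Bochner_Integration.integral_nonneg) simp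
  then have B: "0 < B" using False by (simp only: B_def order_less_le) simp
  have B1: "0 \<le> B1" unfolding B1_def using f by (rule Bochner_Integration.integral_nonneg)
  define a where "a = sqrt (D * B)"
  have a: "0 < a" and a2: "a\<^sup>2 = D * B" using D B by (simp_all add: a_def)
  have pw: "3 * f u ^ 2 \<le> 2 * a * f u + f u ^ 4 / a\<^sup>2" for u
  proof -
    define v where "v = f u / a"
    have v: "0 \<le> v" "f u = a * v" using a f by (simp_all add: v_def)
    have "0 \<le> (v - 1)\<^sup>2 * (v + 2)" using v by simp
    then have "3 * v \<le> 2 + v ^ 3" by (simp add: power2_eq_square power3_eq_cube algebra_simps)
    then have "a\<^sup>2 * v * (3 * v) \<le> a\<^sup>2 * v * (2 + v ^ 3)" using v by (intro mult_left_mono) auto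
    moreover have "f u ^ 4 / a\<^sup>2 = a\<^sup>2 * v * v ^ 3"
      using a by (simp add: v(2) power_mult_distrib power2_eq_square power3_eq_cube power4_eq_xxxx)
    ultimately show ?thesis by (simp add: v(2) power2_eq_square algebra_simps)
  qed
  have "3 * B = (\<integral>u. 3 * f u ^ 2 \<partial>M)" by (simp add: B_def)
  also have "\<dots> \<le> (\<integral>u. 2 * a * f u + f u ^ 4 / a\<^sup>2 \<partial>M)"
    using int pw by (intro integral_mono) auto
  also have "\<dots> = 2 * a * B1 + (\<integral>u. f u ^ 4 \<partial>M) / a\<^sup>2"
    using int by (simp add: B1_def)
  also have "\<dots> \<le> 2 * a * B1 + D * B\<^sup>2 / a\<^sup>2"
    using le a by (intro add_left_mono divide_right_mono) (auto simp: B_def)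
  also have "D * B\<^sup>2 / a\<^sup>2 = B" unfolding a2 using D B by (simp add: power2_eq_square)
  finally have "B \<le> a * B1" by simp
  then have "B * B \<le> (a * B1) * (a * B1)" using B by (intro mult_mono) auto
  also have "\<dots> = B * (D * B1\<^sup>2)" using a2 by (simp add: power2_eq_square mult_ac)
  finally have "B \<le> D * B1\<^sup>2" using B by simp
  then show ?thesis by (simp add: B_def B1_def)
qed

context dirichlet_flow
begin

text \<open>
  The coefficient of \<open>f\<^sup>2\<close> at \<open>z\<close> is a sum over the representations of \<open>z\<close>, of which there are at most \<open>N\<close>;
  hence its square is at most \<open>N\<close> times the sum of the squares of the summands.
\<close>
lemma fourth_moment_le:
  assumes X: "finite X" "X \<subseteq> spectrum"
    and N: "\<And>x y. x \<in> X \<Longrightarrow> y \<in> X \<Longrightarrow> real (card {w \<in> X. x + y - w \<in> X}) \<le> N"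
  shows "(\<integral>u. norm (trig_sum X c u) ^ 4 \<partial>\<mu>) \<le> N * (\<integral>u. norm (trig_sum X c u) ^ 2 \<partial>\<mu>)\<^sup>2"
proof -
  define P where "P z = {(x, y). (x, y) \<in> X \<times> X \<and> x + y = z}" for z
  define e where "e z = (\<Sum>(x, y)\<in>P z. c x * c y)" for z
  define q where "q = (\<lambda>(x, y). norm (c x) ^ 2 * norm (c y) ^ 2)"
  let ?S = "(\<lambda>(x, y). x + y) ` (X \<times> X)"
  have S: "finite ?S" "?S \<subseteq> spectrum" using X spectrum_add(1) by auto
  have "norm (trig_sum X c u) ^ 4 = norm (trig_sum ?S e u) ^ 2" for u
  proof -
    have "trig_sum X c u * trig_sum X c u = trig_sum ?S e u"
      unfolding e_def P_def by (rule trig_sum_mult) (use X in auto)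
    then have "norm (trig_sum X c u) * norm (trig_sum X c u) = norm (trig_sum ?S e u)"
      by (metis norm_mult)
    then show ?thesis by (simp add: power2_eq_square power4_eq_xxxx)
  qed
  then have "(\<integral>u. norm (trig_sum X c u) ^ 4 \<partial>\<mu>) = (\<Sum>z\<in>?S. norm (e z) ^ 2)"
    by (simp add: parseval[OF S])
  also have "\<dots> \<le> (\<Sum>z\<in>?S. N * sum q (P z))"
  proof (rule sum_mono)
    fix z assume "z \<in> ?S"
    then obtain x y where xy: "x \<in> X" "y \<in> X" "z = x + y" by auto
    have "card (P z) = card {w \<in> X. z - w \<in> X}"
      by (rule bij_betw_same_card[of fst], rule bij_betwI[of _ _ _ "\<lambda>w. (w, z - w)"])
         (auto simp: P_def)
    then have card: "real (card (P z)) \<le> N" using N[OF xy(1,2)] xy(3) by simp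
    have q: "0 \<le> sum q (P z)" by (rule sum_nonneg) (auto simp: q_def)
    have "norm (e z) \<le> (\<Sum>p\<in>P z. 1 * norm (c (fst p) * c (snd p)))"
      unfolding e_def by (rule order_trans[OF norm_sum]) (simp add: case_prod_unfold)
    then have "norm (e z) ^ 2 \<le> (\<Sum>p\<in>P z. 1 * norm (c (fst p) * c (snd p)))\<^sup>2"
      by (intro power_mono) auto
    also have "\<dots> \<le> (\<Sum>p\<in>P z. 1\<^sup>2) * (\<Sum>p\<in>P z. (norm (c (fst p) * c (snd p)))\<^sup>2)"
      by (rule Cauchy_Schwarz_ineq_sum)
    also have "\<dots> = real (card (P z)) * sum q (P z)"
      by (simp add: q_def case_prod_unfold norm_mult power_mult_distrib)
    also have "\<dots> \<le> N * sum q (P z)" using card q by (rule mult_right_mono)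
    finally show "norm (e z) ^ 2 \<le> N * sum q (P z)" .
  qed
  also have "\<dots> = N * sum q (X \<times> X)"
  proof -
    have "sum q (X \<times> X) = (\<Sum>z\<in>?S. \<Sum>p | p \<in> X \<times> X \<and> (\<lambda>(x, y). x + y) p = z. q p)"
      using X by (intro sum.image_gen) auto
    also have "\<dots> = (\<Sum>z\<in>?S. sum q (P z))"
      by (intro sum.cong refl) (auto simp: P_def)
    finally show ?thesis by (simp add: sum_distrib_left)
  qed
  also have "sum q (X \<times> X) = (\<integral>u. norm (trig_sum X c u) ^ 2 \<partial>\<mu>)\<^sup>2"
    by (simp add: parseval[OF X] q_def power2_eq_square[of "sum _ _"] sum_product sum.cartesian_product)
  finally show ?thesis .
qed

definition low_polys :: "real set \<Rightarrow> real \<Rightarrow> ('g \<Rightarrow> complex) set" where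
  "low_polys K T = trig_polys (spectrum \<inter> K \<inter> {..T})"

lemma low_polys_square:
  assumes "thin_semigroup K" "f \<in> low_polys K T"
  shows "(\<lambda>u. f u * f u) \<in> low_polys K (2 * T)"
  unfolding low_polys_def
  by (rule trig_polys_mult[OF assms(2)[unfolded low_polys_def] assms(2)[unfolded low_polys_def]])
     (use assms(1) spectrum_add in \<open>auto simp: thin_semigroup_def\<close>)

lemma low_polys_integrable_power:
  assumes "f \<in> low_polys K T"
  shows "integrable \<mu> (\<lambda>u. norm (f u) ^ k)"
  using assms by (auto simp: low_polys_def trig_polys_def intro!: trig_sum_integrable_power)

lemma low_polys_fourth_moment:
  assumes K: "thin_semigroup K" and \<sigma>: "0 < \<sigma>"
  shows "\<exists>C>0. \<forall>T f. f \<in> low_polys K T \<longrightarrow>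
    (\<integral>u. norm (f u) ^ 4 \<partial>\<mu>) \<le> C * exp (\<sigma> * T) * (\<integral>u. norm (f u) ^ 2 \<partial>\<mu>)\<^sup>2"
proof -
  have "0 < \<sigma> / 2" using \<sigma> by simp
  then obtain C where C: "0 < C" and count:
      "\<And>X z. finite X \<Longrightarrow> X \<subseteq> K \<Longrightarrow> real (card {x \<in> X. z - x \<in> X}) \<le> C * exp (\<sigma> / 2 * z)"
    using K unfolding thin_semigroup_def by metis
  have "(\<integral>u. norm (f u) ^ 4 \<partial>\<mu>) \<le> C * exp (\<sigma> * T) * (\<integral>u. norm (f u) ^ 2 \<partial>\<mu>)\<^sup>2"
    if f: "f \<in> low_polys K T" for T f
  proof -
    obtain X c where X: "finite X" "X \<subseteq> spectrum \<inter> K \<inter> {..T}" and fX: "f = trig_sum X c"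
      using f by (auto simp: low_polys_def trig_polys_def)
    show ?thesis unfolding fX
    proof (rule fourth_moment_le)
      fix x y assume xy: "x \<in> X" "y \<in> X"
      have "real (card {w \<in> X. x + y - w \<in> X}) \<le> C * exp (\<sigma> / 2 * (x + y))"
        using X by (intro count) auto
      also have "\<dots> \<le> C * exp (\<sigma> * T)"
      proof -
        have "x \<le> T" "y \<le> T" using X xy by auto
        then have "x + y \<le> 2 * T" by simp
        then have "\<sigma> / 2 * (x + y) \<le> \<sigma> * T" using \<sigma> mult_left_mono[of "x + y" "2 * T" "\<sigma> / 2"] by simp
        then show ?thesis using C by simp
      qed
      finally show "real (card {w \<in> X. x + y - w \<in> X}) \<le> C * exp (\<sigma> * T)" .
    qed (use X in auto)
  qed
  then show ?thesis using C by blast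
qed

text \<open>
  Induction by squaring: \<open>f\<^sup>2\<close> has frequencies up to \<open>2 T\<close> in the same semigroup, and its second moment is
  the fourth moment of \<open>f\<close>. The exponential factors that this costs are paid for by using the previous
  estimates with a smaller \<open>\<sigma>\<close>.
\<close>
lemma low_polys_even_moment:
  assumes K: "thin_semigroup K" and \<sigma>: "0 < \<sigma>"
  shows "\<exists>C>0. \<forall>T f. 0 \<le> T \<longrightarrow> f \<in> low_polys K T \<longrightarrow>
    (\<integral>u. norm (f u) ^ 2 ^ Suc m \<partial>\<mu>) \<le> C * exp (\<sigma> * T) * (\<integral>u. norm (f u) ^ 2 \<partial>\<mu>) ^ 2 ^ m"
  using \<sigma>
proof (induction m arbitrary: \<sigma>)
  case 0
  have "(\<integral>u. norm (f u) ^ 2 \<partial>\<mu>) \<le> exp (\<sigma> * T) * (\<integral>u. norm (f u) ^ 2 \<partial>\<mu>)" if "0 \<le> T"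
    for T and f :: "'g \<Rightarrow> complex"
    using mult_right_mono[of 1 "exp (\<sigma> * T)" "(\<integral>u. norm (f u) ^ 2 \<partial>\<mu>)"] that 0 by simp
  then show ?case by (intro exI[of _ 1]) simp
next
  case (Suc m)
  have "0 < \<sigma> / 4" using Suc.prems by simp
  from Suc.IH[OF this] obtain C where C: "0 < C" and
    IH: "\<And>T f. 0 \<le> T \<Longrightarrow> f \<in> low_polys K T \<Longrightarrow>
      (\<integral>u. norm (f u) ^ 2 ^ Suc m \<partial>\<mu>) \<le> C * exp (\<sigma> / 4 * T) * (\<integral>u. norm (f u) ^ 2 \<partial>\<mu>) ^ 2 ^ m"
    by blast
  \<comment> \<open>The fourth moment enters to the power \<open>2 ^ m\<close>, which turns \<open>\<tau>\<close> into \<open>\<sigma> / 2\<close>.\<close>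
  define \<tau> where "\<tau> = \<sigma> / 2 ^ Suc m"
  have "0 < \<tau>" using Suc.prems by (simp add: \<tau>_def)
  from low_polys_fourth_moment[OF K this] obtain D where D: "0 < D" and
    four: "\<And>T f. f \<in> low_polys K T \<Longrightarrow>
      (\<integral>u. norm (f u) ^ 4 \<partial>\<mu>) \<le> D * exp (\<tau> * T) * (\<integral>u. norm (f u) ^ 2 \<partial>\<mu>)\<^sup>2"
    by blast
  have "(\<integral>u. norm (f u) ^ 2 ^ Suc (Suc m) \<partial>\<mu>)
      \<le> C * D ^ 2 ^ m * exp (\<sigma> * T) * (\<integral>u. norm (f u) ^ 2 \<partial>\<mu>) ^ 2 ^ Suc m"
    if T: "0 \<le> T" and f: "f \<in> low_polys K T" for T f
  proof -
    define B where "B = (\<integral>u. norm (f u) ^ 2 \<partial>\<mu>)"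
    have "(\<integral>u. norm (f u) ^ 2 ^ Suc (Suc m) \<partial>\<mu>) = (\<integral>u. norm (f u * f u) ^ 2 ^ Suc m \<partial>\<mu>)"
      by (simp add: norm_mult power_mult_distrib flip: power_add mult_2)
    also have "\<dots> \<le> C * exp (\<sigma> / 4 * (2 * T)) * (\<integral>u. norm (f u * f u) ^ 2 \<partial>\<mu>) ^ 2 ^ m"
      using T f by (intro IH low_polys_square[OF K]) auto
    also have "(\<integral>u. norm (f u * f u) ^ 2 \<partial>\<mu>) = (\<integral>u. norm (f u) ^ 4 \<partial>\<mu>)"
      by (simp add: norm_mult power_mult_distrib flip: power_add)
    also have "C * exp (\<sigma> / 4 * (2 * T)) * (\<integral>u. norm (f u) ^ 4 \<partial>\<mu>) ^ 2 ^ m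
        \<le> C * exp (\<sigma> / 4 * (2 * T)) * (D * exp (\<tau> * T) * B\<^sup>2) ^ 2 ^ m"
      using C four[OF f] by (intro mult_left_mono power_mono) (auto simp: B_def)
    also have "(D * exp (\<tau> * T) * B\<^sup>2) ^ 2 ^ m = D ^ 2 ^ m * exp (\<sigma> / 2 * T) * B ^ 2 ^ Suc m"
    proof -
      have "exp (\<tau> * T) ^ 2 ^ m = exp (\<sigma> / 2 * T)"
        by (simp add: \<tau>_def field_simps flip: exp_of_nat_mult)
      then show ?thesis by (simp add: power_mult_distrib flip: power_mult)
    qed
    also have "C * exp (\<sigma> / 4 * (2 * T)) * (D ^ 2 ^ m * exp (\<sigma> / 2 * T) * B ^ 2 ^ Suc m)
        = C * D ^ 2 ^ m * (exp (\<sigma> / 2 * T) * exp (\<sigma> / 2 * T)) * B ^ 2 ^ Suc m"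
      by (simp add: mult_ac)
    also have "exp (\<sigma> / 2 * T) * exp (\<sigma> / 2 * T) = exp (\<sigma> * T)" by (simp flip: exp_add)
    finally show ?thesis by (simp add: B_def)
  qed
  moreover have "0 < C * D ^ 2 ^ m" using C D by simp
  ultimately show ?case by blast
qed

lemma low_polys_second_moment:
  assumes K: "thin_semigroup K" and \<sigma>: "0 < \<sigma>"
  shows "\<exists>C>0. \<forall>T f. f \<in> low_polys K T \<longrightarrow>
    (\<integral>u. norm (f u) ^ 2 \<partial>\<mu>) \<le> C * exp (\<sigma> * T) * (\<integral>u. norm (f u) \<partial>\<mu>)\<^sup>2"
proof -
  obtain C where C: "0 < C" and four: "\<And>T f. f \<in> low_polys K T \<Longrightarrow>
      (\<integral>u. norm (f u) ^ 4 \<partial>\<mu>) \<le> C * exp (\<sigma> * T) * (\<integral>u. norm (f u) ^ 2 \<partial>\<mu>)\<^sup>2"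
    using low_polys_fourth_moment[OF K \<sigma>] by blast
  have "(\<integral>u. norm (f u) ^ 2 \<partial>\<mu>) \<le> C * exp (\<sigma> * T) * (\<integral>u. norm (f u) \<partial>\<mu>)\<^sup>2"
    if f: "f \<in> low_polys K T" for T f
    using C four[OF f] low_polys_integrable_power[OF f, of 1]
    by (intro second_moment_le_first low_polys_integrable_power[OF f]) auto
  then show ?thesis using C by blast
qed

end

section \<open>Windowing a spectrum contracts the mean\<close>

context dirichlet_flow
begin

lemma trig_polys_real_polynomial:
  fixes p :: "real \<Rightarrow> real"
  assumes "real_polynomial_function p" "(\<lambda>u. complex_of_real (r u)) \<in> trig_polys spectrum"
  shows "(\<lambda>u. complex_of_real (p (r u))) \<in> trig_polys spectrum"
  using assms(1)
proof induction
  case (linear p)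
  have "p y = y * p 1" for y using linear_cmul[OF bounded_linear.linear[OF linear], of y 1] by simp
  then have eq: "(\<lambda>u. complex_of_real (p (r u))) = (\<lambda>u. complex_of_real (r u) * complex_of_real (p 1))"
    by (metis of_real_mult)
  show ?case unfolding eq
    by (rule trig_polys_mult[OF assms(2) trig_polys_const]) (auto intro: spectrum_add)
next
  case (const c)
  show ?case by (rule trig_polys_const)
next
  case (add p q)
  then show ?case using trig_polys_add by simp
next
  case (mult p q)
  show ?case unfolding of_real_mult
    by (rule trig_polys_mult[OF mult.IH]) (auto intro: spectrum_add)
qed

text \<open>
  The \<open>L\<^sub>1\<close> norm is attained by pairing \<open>f\<close> with its conjugate phase. The bounded function
  \<open>cnj f / (\<bar>f\<bar> + \<epsilon>)\<close> is nearly that phase and, with \<open>1 / (sqrt y + \<epsilon>)\<close> replaced by a polynomial in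
  \<open>y = \<bar>f\<bar>\<^sup>2\<close> close to it, becomes a trigonometric polynomial.
\<close>
lemma L1_norm_le_by_duality:
  assumes f: "f \<in> trig_polys spectrum"
    and dual: "\<And>\<psi> M. \<psi> \<in> trig_polys spectrum \<Longrightarrow> (\<And>u. norm (\<psi> u) \<le> M) \<Longrightarrow>
      norm (\<integral>u. f u * \<psi> u \<partial>\<mu>) \<le> K * M"
  shows "(\<integral>u. norm (f u) \<partial>\<mu>) \<le> K"
proof -
  have "0 \<le> K" using dual[OF trig_polys_const[of 0], of 1] by simp
  obtain X c where X: "finite X" "X \<subseteq> spectrum" "f = trig_sum X c"
    using f by (auto simp: trig_polys_def)
  define B where "B = (\<Sum>x\<in>X. norm (c x))"
  have B: "norm (f u) \<le> B" "0 \<le> B" for u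
    using trig_sum_bound[OF X(2)] by (auto simp: X(3) B_def intro: sum_nonneg)
  have cont: "continuous_on UNIV f" unfolding X(3) by (rule trig_sum_continuous[OF X(2)])
  have int_f: "integrable \<mu> (\<lambda>u. norm (f u))"
    using trig_sum_integrable_power[OF X(2), of c 1] by (simp add: X(3))
  have approx: "(\<integral>u. norm (f u) \<partial>\<mu>) \<le> K + \<epsilon> * (K + 2)" if \<epsilon>: "0 < \<epsilon>" for \<epsilon>
  proof -
    \<comment> \<open>\<open>\<eta>\<close> makes the error at most \<open>\<epsilon>\<close>, both in the bound on \<open>\<psi>\<close> and in its pairing with \<open>f\<close>.\<close>
    define \<eta> where "\<eta> = \<epsilon> / (B + 1)\<^sup>2"
    have \<eta>: "0 < \<eta>" using \<epsilon> B by (simp add: \<eta>_def)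
    have B\<eta>: "B * \<eta> \<le> \<epsilon>" "B\<^sup>2 * \<eta> \<le> \<epsilon>"
    proof -
      have "B \<le> (B + 1)\<^sup>2" "B\<^sup>2 \<le> (B + 1)\<^sup>2" using B by (simp_all add: power2_eq_square algebra_simps)
      then show "B * \<eta> \<le> \<epsilon>" "B\<^sup>2 * \<eta> \<le> \<epsilon>"
        using \<epsilon> B by (simp_all add: \<eta>_def divide_le_eq mult.commute[of _ \<epsilon>] mult_left_mono
            add_nonneg_eq_0_iff)
    qed
    have "continuous_on {0..B\<^sup>2} (\<lambda>y. 1 / (sqrt y + \<epsilon>))"
    proof (intro continuous_intros ballI)
      show "sqrt y + \<epsilon> \<noteq> 0" if "y \<in> {0..B\<^sup>2}" for y
        using \<epsilon> real_sqrt_ge_zero[of y] that by (metis add_nonneg_pos atLeastAtMost_iff less_irrefl)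
    qed
    then obtain p where p: "real_polynomial_function p"
      and close: "\<And>y. y \<in> {0..B\<^sup>2} \<Longrightarrow> \<bar>1 / (sqrt y + \<epsilon>) - p y\<bar> < \<eta>"
      using Stone_Weierstrass_real_polynomial_function[of "{0..B\<^sup>2}"] \<eta> by blast
    define \<psi> where "\<psi> u = cnj (f u) * complex_of_real (p (norm (f u) ^ 2))" for u
    have sq: "(\<lambda>u. complex_of_real (norm (f u) ^ 2)) \<in> trig_polys spectrum"
      unfolding complex_norm_square
      by (rule trig_polys_mult[OF f trig_polys_cnj[OF f]]) (auto intro: spectrum_add)
    have \<psi>: "\<psi> \<in> trig_polys spectrum"
      unfolding \<psi>_def
      by (rule trig_polys_mult[OF trig_polys_cnj[OF f] trig_polys_real_polynomial[OF p sq]])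
        (auto intro: spectrum_add)
    have p_close: "\<bar>1 / (norm (f u) + \<epsilon>) - p (norm (f u) ^ 2)\<bar> < \<eta>" for u
      using close[of "norm (f u) ^ 2"] B(1)[of u] by (simp add: power_mono)
    have \<psi>_le: "norm (\<psi> u) \<le> 1 + \<epsilon>" for u
    proof -
      have "\<bar>p (norm (f u) ^ 2)\<bar> \<le> \<bar>1 / (norm (f u) + \<epsilon>)\<bar> + \<eta>" using p_close[of u] by linarith
      then have "norm (\<psi> u) \<le> norm (f u) * (\<bar>1 / (norm (f u) + \<epsilon>)\<bar> + \<eta>)"
        by (simp add: \<psi>_def norm_mult mult_left_mono)
      also have "\<dots> = norm (f u) / (norm (f u) + \<epsilon>) + norm (f u) * \<eta>"
        using \<epsilon> by (simp add: distrib_left add_nonneg_pos abs_of_pos)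
      also have "\<dots> \<le> 1 + B * \<eta>"
        using \<epsilon> \<eta> B(1)[of u] by (intro add_mono mult_right_mono) (auto simp: divide_le_eq add_nonneg_pos)
      finally show ?thesis using B\<eta> by linarith
    qed
    have f\<psi>: "f u * \<psi> u = complex_of_real (norm (f u) ^ 2 * p (norm (f u) ^ 2))" for u
      by (simp add: \<psi>_def mult.assoc[symmetric] complex_norm_square[symmetric] del: of_real_power)
    have lower: "norm (f u) - 2 * \<epsilon> \<le> norm (f u) ^ 2 * p (norm (f u) ^ 2)" for u
    proof -
      have pos: "0 < norm (f u) + \<epsilon>" using \<epsilon> by (simp add: add_nonneg_pos)
      have "norm (f u) - \<epsilon> \<le> norm (f u) ^ 2 * (1 / (norm (f u) + \<epsilon>))"
        using pos by (simp add: le_divide_eq power2_eq_square algebra_simps)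
      moreover have "norm (f u) ^ 2 * (1 / (norm (f u) + \<epsilon>) - \<eta>) \<le> norm (f u) ^ 2 * p (norm (f u) ^ 2)"
        using p_close[of u] by (intro mult_left_mono) auto
      moreover have "norm (f u) ^ 2 * \<eta> \<le> B\<^sup>2 * \<eta>"
        using B(1)[of u] \<eta> by (intro mult_right_mono power_mono) auto
      ultimately show ?thesis using B\<eta>(2) by (simp add: right_diff_distrib)
    qed
    obtain Y d where Y: "finite Y" "Y \<subseteq> spectrum" "\<psi> = trig_sum Y d"
      using \<psi> by (auto simp: trig_polys_def)
    have int: "integrable \<mu> (\<lambda>u. norm (f u) ^ 2 * p (norm (f u) ^ 2))"
    proof (rule integrable_continuous_bounded)
      have eq: "(\<lambda>u. norm (f u) ^ 2 * p (norm (f u) ^ 2)) = (\<lambda>u. Re (f u * \<psi> u))"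
        unfolding f\<psi> by simp
      show "continuous_on UNIV (\<lambda>u. norm (f u) ^ 2 * p (norm (f u) ^ 2))"
        unfolding eq Y(3) by (intro continuous_intros cont trig_sum_continuous Y)
      have "norm (f u * \<psi> u) \<le> B * (1 + \<epsilon>)" for u
        unfolding norm_mult using B(1)[of u] \<psi>_le[of u] \<epsilon> B(2) by (intro mult_mono) auto
      then show "norm (norm (f u) ^ 2 * p (norm (f u) ^ 2)) \<le> B * (1 + \<epsilon>)" for u
        unfolding f\<psi> norm_of_real by simp
    qed
    have "(\<integral>u. norm (f u) \<partial>\<mu>) - 2 * \<epsilon> = (\<integral>u. norm (f u) - 2 * \<epsilon> \<partial>\<mu>)" using int_f by simp
    also have "\<dots> \<le> (\<integral>u. norm (f u) ^ 2 * p (norm (f u) ^ 2) \<partial>\<mu>)"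
      using int_f int lower by (intro integral_mono) auto
    also have "\<dots> \<le> norm (\<integral>u. f u * \<psi> u \<partial>\<mu>)"
      unfolding f\<psi> integral_complex_of_real norm_of_real by (rule abs_ge_self)
    also have "\<dots> \<le> K * (1 + \<epsilon>)" by (rule dual[OF \<psi> \<psi>_le])
    finally show ?thesis by (simp add: algebra_simps)
  qed
  show ?thesis
  proof (rule field_le_epsilon)
    fix e :: real assume "0 < e"
    then show "(\<integral>u. norm (f u) \<partial>\<mu>) \<le> K + e"
      using approx[of "e / (K + 2)"] \<open>0 \<le> K\<close> by simp
  qed
qed

text \<open>
  The reflection \<open>- y\<close> arises because Fourier coefficients conjugate the character.
\<close>
lemma integral_times_trig_sum:
  assumes f: "integrable \<mu> f" and Y: "finite Y" "Y \<subseteq> spectrum"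
  shows "integrable \<mu> (\<lambda>u. f u * trig_sum Y c u)"
    and "(\<integral>u. f u * trig_sum Y c u \<partial>\<mu>) = (\<Sum>y\<in>Y. c y * fourier_coeff \<mu> f (h (- y)))"
proof -
  have int: "integrable \<mu> (\<lambda>u. c y * (f u * h y u))" if "y \<in> Y" for y
  proof (rule integrable_mult_right, rule Bochner_Integration.integrable_bound[OF f])
    have y: "y \<in> spectrum" using that Y by auto
    show "(\<lambda>u. f u * h y u) \<in> borel_measurable \<mu>"
      using borel_measurable_integrable[OF f] continuous_imp_measurable[OF continuous_freq_char[OF y]]
      by (rule borel_measurable_times)
    show "AE u in \<mu>. norm (f u * h y u) \<le> norm (f u)" using y by (simp add: norm_mult)
  qed
  have eq: "(\<lambda>u. f u * trig_sum Y c u) = (\<lambda>u. \<Sum>y\<in>Y. c y * (f u * h y u))"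
    by (simp add: trig_sum_def sum_distrib_left mult_ac)
  show "integrable \<mu> (\<lambda>u. f u * trig_sum Y c u)" unfolding eq by (rule Bochner_Integration.integrable_sum[OF int])
  have "(\<integral>u. f u * trig_sum Y c u \<partial>\<mu>) = (\<Sum>y\<in>Y. \<integral>u. c y * (f u * h y u) \<partial>\<mu>)"
    unfolding eq by (rule Bochner_Integration.integral_sum[OF int])
  also have "\<dots> = (\<Sum>y\<in>Y. c y * fourier_coeff \<mu> f (h (- y)))"
    using Y by (intro sum.cong refl) (auto simp: fourier_coeff_def spectrum_uminus(2) subset_iff)
  finally show "(\<integral>u. f u * trig_sum Y c u \<partial>\<mu>) = (\<Sum>y\<in>Y. c y * fourier_coeff \<mu> f (h (- y)))" .
qed

text \<open>
  The window can be moved from \<open>f\<close> to the test polynomial \<open>\<psi>\<close>. There it acts on each translate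
  \<open>t \<mapsto> \<psi> (u + \<beta> t)\<close>, an almost periodic polynomial on the line, as an average that preserves uniform bounds.
  The hypothesis says that \<open>X\<close> contains all frequencies of \<open>f\<close> that the window sees.
\<close>
lemma window_L1_contraction:
  assumes f: "integrable \<mu> f" and X: "finite X" "X \<subseteq> spectrum"
    and off: "\<And>y. y \<in> spectrum \<Longrightarrow> y \<notin> X \<Longrightarrow> tent (y - k) * fourier_coeff \<mu> f (h y) = 0"
  shows "(\<integral>u. norm (trig_sum X (\<lambda>x. tent (x - k) * fourier_coeff \<mu> f (h x)) u) \<partial>\<mu>)
    \<le> (\<integral>u. norm (f u) \<partial>\<mu>)"
proof (rule L1_norm_le_by_duality)
  let ?F = "trig_sum X (\<lambda>x. tent (x - k) * fourier_coeff \<mu> f (h x))"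
  show "?F \<in> trig_polys spectrum" using X by (auto simp: trig_polys_def)
  fix \<psi> M assume \<psi>: "\<psi> \<in> trig_polys spectrum" and M: "\<And>u. norm (\<psi> u) \<le> M"
  obtain Y c where Y: "finite Y" "Y \<subseteq> spectrum" "\<psi> = trig_sum Y c"
    using \<psi> by (auto simp: trig_polys_def)
  define \<psi>' where "\<psi>' = trig_sum Y (\<lambda>y. tent (y - - k) * c y)"
  have "integrable \<mu> ?F"
    by (rule integrable_continuous_bounded[OF trig_sum_continuous[OF X(2)] trig_sum_bound[OF X(2)]])
  then have "(\<integral>u. ?F u * \<psi> u \<partial>\<mu>) = (\<Sum>y\<in>Y. c y * fourier_coeff \<mu> ?F (h (- y)))"
    unfolding Y(3) by (rule integral_times_trig_sum(2)[OF _ Y(1,2)])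
  also have "\<dots> = (\<Sum>y\<in>Y. (tent (y - - k) * c y) * fourier_coeff \<mu> f (h (- y)))"
  proof (rule sum.cong[OF refl])
    fix y assume "y \<in> Y"
    then have y: "- y \<in> spectrum" using Y spectrum_uminus by auto
    have "fourier_coeff \<mu> ?F (h (- y)) = tent (- y - k) * fourier_coeff \<mu> f (h (- y))"
      using trig_sum_coefficient[OF X y] off[OF y] by auto
    moreover have "tent (- y - k) = tent (y - - k)" by (simp add: tent_def abs_minus_commute)
    ultimately show "c y * fourier_coeff \<mu> ?F (h (- y)) = (tent (y - - k) * c y) * fourier_coeff \<mu> f (h (- y))"
      by simp
  qed
  also have "\<dots> = (\<integral>u. f u * \<psi>' u \<partial>\<mu>)"
    unfolding \<psi>'_def by (rule integral_times_trig_sum(2)[OF f Y(1,2), symmetric])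
  finally have eq: "(\<integral>u. ?F u * \<psi> u \<partial>\<mu>) = (\<integral>u. f u * \<psi>' u \<partial>\<mu>)" .
  have bound: "norm (\<psi>' u) \<le> M" for u
  proof -
    have "\<psi> (u + \<beta> t) = (\<Sum>y\<in>Y. (c y * h y u) * cis (- (y * t)))" for t
      unfolding Y(3) trig_sum_def
    proof (rule sum.cong[OF refl])
      fix y assume "y \<in> Y"
      then have "y \<in> spectrum" using Y by auto
      then show "c y * h y (u + \<beta> t) = (c y * h y u) * cis (- (y * t))"
        by (simp add: freq_char_hom freq_char_flow)
    qed
    then have "norm (\<Sum>y\<in>Y. (c y * h y u) * cis (- (y * t))) \<le> M" for t using M by metis
    from tent_multiplier_bound[OF Y(1) this, of "- k"] show ?thesis
      by (simp add: \<psi>'_def trig_sum_def mult_ac)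
  qed
  have "norm (\<integral>u. f u * \<psi>' u \<partial>\<mu>) \<le> (\<integral>u. norm (f u * \<psi>' u) \<partial>\<mu>)"
    by (rule integral_norm_bound)
  also have "\<dots> \<le> (\<integral>u. norm (f u) * M \<partial>\<mu>)"
  proof (rule integral_mono)
    show "integrable \<mu> (\<lambda>u. norm (f u * \<psi>' u))"
      unfolding \<psi>'_def by (intro integrable_norm integral_times_trig_sum(1)[OF f Y(1,2)])
    show "integrable \<mu> (\<lambda>u. norm (f u) * M)" using f by simp
    show "norm (f u * \<psi>' u) \<le> norm (f u) * M" for u
      unfolding norm_mult using bound by (intro mult_left_mono) auto
  qed
  finally show "norm (\<integral>u. ?F u * \<psi> u \<partial>\<mu>) \<le> (\<integral>u. norm (f u) \<partial>\<mu>) * M"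
    unfolding eq by simp
qed

end

section \<open>Norms and geometric series on a probability space\<close>

text \<open>
  Young's inequality \<open>y\<^sup>\<theta> A\<^sup>1\<^sup>-\<^sup>\<theta> \<le> \<theta> y + (1 - \<theta>) A\<close>, with \<open>y = \<bar>f\<bar>\<^sup>s\<close>, \<open>\<theta> = r / s\<close> and \<open>A\<close> the mean of \<open>y\<close>,
  integrates to \<open>\<integral>\<bar>f\<bar>\<^sup>r \<le> A\<^sup>\<theta>\<close>.
\<close>
lemma (in prob_space) Lp_mono:
  assumes r: "0 < r" "r \<le> s" and f: "f \<in> Lp M s"
  shows "f \<in> Lp M r" and "Lp_norm M r f \<le> Lp_norm M s f"
proof -
  have meas [measurable]: "f \<in> borel_measurable M" and int_s: "integrable M (\<lambda>x. norm (f x) powr s)"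
    using f by (auto simp: Lp_def)
  have int_r: "integrable M (\<lambda>x. norm (f x) powr r)"
  proof (rule Bochner_Integration.integrable_bound)
    show "integrable M (\<lambda>x. 1 + norm (f x) powr s)" using int_s by simp
    have "y powr r \<le> 1 + y powr s" if "0 \<le> y" for y :: real
    proof (cases "y \<le> 1")
      case True
      then have "y powr r \<le> 1" using that r powr_le1 by simp
      then show ?thesis by (simp add: add_increasing2)
    next
      case False
      then have "y powr r \<le> y powr s" using r by (intro powr_mono) auto
      then show ?thesis by simp
    qed
    then show "AE x in M. norm (norm (f x) powr r) \<le> norm (1 + norm (f x) powr s)"
      by (intro AE_I2) (simp add: abs_of_nonneg add_nonneg_nonneg)
  qed measurable
  then show "f \<in> Lp M r" by (simp add: Lp_def)
  define A where "A = (\<integral>x. norm (f x) powr s \<partial>M)"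
  define \<theta> where "\<theta> = r / s"
  have \<theta>: "0 < \<theta>" "\<theta> \<le> 1" using r by (auto simp: \<theta>_def)
  have "0 \<le> A" unfolding A_def by (rule Bochner_Integration.integral_nonneg) simp
  have "(\<integral>x. norm (f x) powr r \<partial>M) \<le> A powr \<theta>"
  proof (cases "A = 0")
    case True
    then have "AE x in M. norm (f x) powr s = 0"
      using integral_nonneg_eq_0_iff_AE[OF int_s] by (simp add: A_def)
    then have "AE x in M. norm (f x) powr r = 0" by eventually_elim simp
    then have "(\<integral>x. norm (f x) powr r \<partial>M) = 0" by (rule integral_eq_zero_AE)
    then show ?thesis by simp
  next
    case False
    then have A: "0 < A" using \<open>0 \<le> A\<close> by simp
    have "norm (f x) powr r * A powr (1 - \<theta>) \<le> \<theta> * norm (f x) powr s + (1 - \<theta>) * A" for x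
    proof (cases "f x = 0")
      case True
      then show ?thesis using A \<theta> by simp
    next
      case False
      have "(norm (f x) powr s) powr \<theta> * A powr (1 - \<theta>) \<le> \<theta> * norm (f x) powr s + (1 - \<theta>) * A"
        using A \<theta> False by (intro Youngs_inequality_0) auto
      moreover have "s * \<theta> = r" using r by (simp add: \<theta>_def)
      ultimately show ?thesis by (simp add: powr_powr)
    qed
    then have "(\<integral>x. norm (f x) powr r * A powr (1 - \<theta>) \<partial>M)
        \<le> (\<integral>x. \<theta> * norm (f x) powr s + (1 - \<theta>) * A \<partial>M)"
      using int_r int_s by (intro integral_mono) auto
    also have "\<dots> = \<theta> * A + (1 - \<theta>) * A" using int_s by (simp add: A_def prob_space)
    also have "\<dots> = A powr \<theta> * A powr (1 - \<theta>)"
      using A by (simp add: powr_add[symmetric] algebra_simps)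
    finally show ?thesis using A by simp
  qed
  moreover have "0 \<le> (\<integral>x. norm (f x) powr r \<partial>M)"
    by (rule Bochner_Integration.integral_nonneg) simp
  ultimately have "(\<integral>x. norm (f x) powr r \<partial>M) powr (1 / r) \<le> (A powr \<theta>) powr (1 / r)"
    using r by (intro powr_mono2) auto
  also have "\<dots> = A powr (1 / s)" using r by (simp add: powr_powr \<theta>_def)
  finally show "Lp_norm M r f \<le> Lp_norm M s f" by (simp add: Lp_norm_def A_def)
qed

lemma Lp_norm_realpow:
  assumes "0 < N"
  shows "f \<in> Lp M (real N) \<longleftrightarrow> f \<in> borel_measurable M \<and> integrable M (\<lambda>x. norm (f x) ^ N)"
    and "0 \<le> A \<Longrightarrow> (\<integral>x. norm (f x) ^ N \<partial>M) \<le> A ^ N \<Longrightarrow> Lp_norm M (real N) f \<le> A"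
proof -
  have eq: "norm (f x) powr real N = norm (f x) ^ N" for x
    using assms powr_realpow'[of "norm (f x)" N] by simp
  show "f \<in> Lp M (real N) \<longleftrightarrow> f \<in> borel_measurable M \<and> integrable M (\<lambda>x. norm (f x) ^ N)"
    by (simp add: Lp_def eq)
  assume A: "0 \<le> A" "(\<integral>x. norm (f x) ^ N \<partial>M) \<le> A ^ N"
  have "0 \<le> (\<integral>x. norm (f x) ^ N \<partial>M)" by (rule Bochner_Integration.integral_nonneg) simp
  then have "Lp_norm M (real N) f \<le> (A ^ N) powr (1 / real N)"
    unfolding Lp_norm_def eq using A(2) by (intro powr_mono2) auto
  also have "\<dots> = A"
    using A(1) assms by (simp add: powr_realpow'[symmetric] powr_powr)
  finally show "Lp_norm M (real N) f \<le> A" .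
qed

text \<open>
  For exponents that are powers of two, Jensen's inequality for sub-probability weights is iterated
  Cauchy-Schwarz.
\<close>
lemma weighted_power_mean:
  fixes \<theta> y :: "'a \<Rightarrow> real"
  assumes "\<And>i. i \<in> I \<Longrightarrow> 0 \<le> \<theta> i" "sum \<theta> I \<le> 1" "\<And>i. i \<in> I \<Longrightarrow> 0 \<le> y i"
  shows "(\<Sum>i\<in>I. \<theta> i * y i) ^ 2 ^ m \<le> (\<Sum>i\<in>I. \<theta> i * y i ^ 2 ^ m)"
proof (induction m)
  case (Suc m)
  have pos: "0 \<le> (\<Sum>i\<in>I. \<theta> i * (y i ^ 2 ^ m)\<^sup>2)" using assms by (intro sum_nonneg) auto
  have "(\<Sum>i\<in>I. \<theta> i * y i) ^ 2 ^ Suc m = ((\<Sum>i\<in>I. \<theta> i * y i) ^ 2 ^ m)\<^sup>2"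
    by (simp add: power_mult[symmetric] mult.commute)
  also have "\<dots> \<le> (\<Sum>i\<in>I. \<theta> i * y i ^ 2 ^ m)\<^sup>2"
    using Suc assms by (intro power_mono zero_le_power sum_nonneg mult_nonneg_nonneg) auto
  also have "(\<Sum>i\<in>I. \<theta> i * y i ^ 2 ^ m) = (\<Sum>i\<in>I. sqrt (\<theta> i) * (sqrt (\<theta> i) * y i ^ 2 ^ m))"
    using assms by (intro sum.cong refl) (simp add: mult.assoc[symmetric])
  also have "\<dots>\<^sup>2 \<le> (\<Sum>i\<in>I. (sqrt (\<theta> i))\<^sup>2) * (\<Sum>i\<in>I. (sqrt (\<theta> i) * y i ^ 2 ^ m)\<^sup>2)"
    by (rule Cauchy_Schwarz_ineq_sum)
  also have "\<dots> = sum \<theta> I * (\<Sum>i\<in>I. \<theta> i * (y i ^ 2 ^ m)\<^sup>2)"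
    using assms by (simp add: power_mult_distrib)
  also have "\<dots> \<le> 1 * (\<Sum>i\<in>I. \<theta> i * (y i ^ 2 ^ m)\<^sup>2)"
    using assms(2) pos by (rule mult_right_mono)
  finally show ?case by (simp add: power_mult[symmetric] mult.commute)
qed simp

lemma AE_summable_norm:
  fixes g :: "nat \<Rightarrow> 'a \<Rightarrow> 'b::{banach, second_countable_topology}"
  assumes int: "\<And>k. integrable M (g k)" and sm: "summable (\<lambda>k. \<integral>x. norm (g k x) \<partial>M)"
  shows "AE x in M. summable (\<lambda>k. norm (g k x))"
proof -
  have [measurable]: "g k \<in> borel_measurable M" for k using int by auto
  have "(\<integral>\<^sup>+x. (\<Sum>k. ennreal (norm (g k x))) \<partial>M) = (\<Sum>k. \<integral>\<^sup>+x. ennreal (norm (g k x)) \<partial>M)"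
    by (rule nn_integral_suminf) measurable
  also have "\<dots> = (\<Sum>k. ennreal (\<integral>x. norm (g k x) \<partial>M))"
    by (intro suminf_cong nn_integral_eq_integral integrable_norm int) auto
  also have "\<dots> \<noteq> \<infinity>" using sm by (simp add: ennreal_suminf_neq_top)
  finally have "AE x in M. (\<Sum>k. ennreal (norm (g k x))) \<noteq> \<infinity>"
    by (intro nn_integral_PInf_AE) auto
  then show ?thesis
    by eventually_elim (auto intro: summable_suminf_not_top)
qed

text \<open>
  The triangle inequality and completeness of \<open>L\<^sub>N\<close>, for geometrically decaying terms. With weights
  \<open>\<theta>\<^sub>k\<close> proportional to \<open>\<rho>\<^sup>k\<close>, the power mean inequality dominates \<open>(\<Sum>k. \<bar>g\<^sub>k\<bar>)\<^sup>N\<close> pointwise by the series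
  \<open>\<Sum>k. \<theta>\<^sub>k (\<bar>g\<^sub>k\<bar> / \<theta>\<^sub>k)\<^sup>N\<close>, which can be integrated term by term.
\<close>
lemma (in prob_space) geometric_series_Lp:
  fixes g :: "nat \<Rightarrow> 'a \<Rightarrow> complex" and m :: nat
  defines "N \<equiv> 2 ^ m"
  assumes g: "\<And>k. g k \<in> Lp M (real N)" and A: "0 \<le> A" and \<rho>: "0 < \<rho>" "\<rho> < 1"
    and le: "\<And>k. (\<integral>x. norm (g k x) ^ N \<partial>M) \<le> (A * \<rho> ^ k) ^ N"
  shows "integrable M (g k)" "AE x in M. summable (\<lambda>k. norm (g k x))"
    "summable (\<lambda>k. \<integral>x. norm (g k x) \<partial>M)"
    "(\<lambda>x. \<Sum>k. g k x) \<in> Lp M (real N)" "Lp_norm M (real N) (\<lambda>x. \<Sum>k. g k x) \<le> A / (1 - \<rho>)"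
proof -
  have N: "0 < N" "1 \<le> real N" by (simp_all add: N_def)
  have meas [measurable]: "g k \<in> borel_measurable M" and intN: "integrable M (\<lambda>x. norm (g k x) ^ N)" for k
    using g[of k] by (simp_all add: Lp_norm_realpow(1)[OF N(1)])
  have "g k \<in> Lp M 1" for k using Lp_mono(1)[OF _ N(2) g] by simp
  then have int: "integrable M (g k)" for k
    by (simp add: Lp_def integrable_norm_iff)
  then show "integrable M (g k)" .
  have "Lp_norm M 1 (g k) \<le> A * \<rho> ^ k" for k
    using Lp_mono(2)[OF _ N(2) g[of k]] Lp_norm_realpow(2)[OF N(1) _ le[of k]] A \<rho> by force
  then have L1: "(\<integral>x. norm (g k x) \<partial>M) \<le> A * \<rho> ^ k" for k
    by (simp add: Lp_norm_def)
  show sm: "summable (\<lambda>k. \<integral>x. norm (g k x) \<partial>M)"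
  proof (rule summable_comparison_test')
    show "summable (\<lambda>k. A * \<rho> ^ k)" using \<rho> by (intro summable_mult summable_geometric) simp
    show "norm (\<integral>x. norm (g k x) \<partial>M) \<le> A * \<rho> ^ k" if "0 \<le> k" for k using L1[of k] by simp
  qed
  show AE_sm: "AE x in M. summable (\<lambda>k. norm (g k x))"
    by (rule AE_summable_norm[OF int sm])
  define \<theta> where "\<theta> k = (1 - \<rho>) * \<rho> ^ k" for k
  have \<theta>: "0 < \<theta> k" for k using \<rho> by (simp add: \<theta>_def)
  have \<theta>_sum: "sum \<theta> {..<n} \<le> 1" for n
    using \<rho> by (simp add: \<theta>_def sum_distrib_left[symmetric] sum_gp_strict)
  define H where "H k x = \<theta> k * (norm (g k x) / \<theta> k) ^ N" for k x
  have H_nonneg: "0 \<le> H k x" for k x using \<theta>[of k] by (simp add: H_def)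
  have H_eq: "H k x = \<theta> k / \<theta> k ^ N * norm (g k x) ^ N" for k x
    by (simp add: H_def power_divide)
  have H_int: "integrable M (H k)" for k unfolding H_eq using intN by simp
  have H_le: "(\<integral>x. H k x \<partial>M) \<le> \<theta> k * (A / (1 - \<rho>)) ^ N" for k
  proof -
    have "(\<integral>x. H k x \<partial>M) = \<theta> k / \<theta> k ^ N * (\<integral>x. norm (g k x) ^ N \<partial>M)" unfolding H_eq by simp
    also have "\<dots> \<le> \<theta> k / \<theta> k ^ N * (A * \<rho> ^ k) ^ N"
      using \<theta>[of k] le by (intro mult_left_mono) auto
    also have "\<dots> = \<theta> k * (A * \<rho> ^ k / \<theta> k) ^ N" by (simp add: power_divide)
    also have "A * \<rho> ^ k / \<theta> k = A / (1 - \<rho>)" using \<rho> by (simp add: \<theta>_def)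
    finally show ?thesis .
  qed
  have \<theta>_sums: "\<theta> sums 1"
    using sums_mult[OF geometric_sums[of \<rho>], of "1 - \<rho>"] \<rho> by (simp add: \<theta>_def[abs_def])
  have H_sm: "summable (\<lambda>k. \<integral>x. norm (H k x) \<partial>M)"
  proof (rule summable_comparison_test')
    show "summable (\<lambda>k. \<theta> k * (A / (1 - \<rho>)) ^ N)" using \<theta>_sums by (intro summable_mult2) (rule sums_summable)
    show "norm (\<integral>x. norm (H k x) \<partial>M) \<le> \<theta> k * (A / (1 - \<rho>)) ^ N" if "0 \<le> k" for k
      using H_le[of k] H_nonneg by (simp add: abs_of_nonneg Bochner_Integration.integral_nonneg)
  qed
  have AE_H: "AE x in M. summable (\<lambda>k. norm (H k x))" by (rule AE_summable_norm[OF H_int H_sm])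
  have int_H: "integrable M (\<lambda>x. \<Sum>k. H k x)" by (rule integrable_suminf[OF H_int AE_H H_sm])
  have pw: "AE x in M. norm (\<Sum>k. g k x) ^ N \<le> (\<Sum>k. H k x)"
    using AE_sm AE_H
  proof eventually_elim
    fix x assume gx: "summable (\<lambda>k. norm (g k x))" and Hx: "summable (\<lambda>k. norm (H k x))"
    have Hx: "summable (\<lambda>k. H k x)" using Hx by (rule summable_norm_cancel)
    have "(\<Sum>k<n. norm (g k x)) ^ N \<le> (\<Sum>k. H k x)" for n
    proof -
      have "(\<Sum>k<n. norm (g k x)) = (\<Sum>k<n. \<theta> k * (norm (g k x) / \<theta> k))"
        using \<theta> by (intro sum.cong refl) (simp add: less_imp_neq[symmetric])
      also have "\<dots> ^ N \<le> (\<Sum>k<n. \<theta> k * (norm (g k x) / \<theta> k) ^ N)"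
        unfolding N_def using \<theta> \<theta>_sum by (intro weighted_power_mean) (auto simp: less_imp_le)
      also have "\<dots> \<le> (\<Sum>k. H k x)"
        unfolding H_def[symmetric] using Hx H_nonneg by (intro sum_le_suminf) auto
      finally show ?thesis .
    qed
    moreover have "(\<lambda>n. (\<Sum>k<n. norm (g k x)) ^ N) \<longlonglongrightarrow> (\<Sum>k. norm (g k x)) ^ N"
      using gx by (intro tendsto_power summable_LIMSEQ)
    ultimately have "(\<Sum>k. norm (g k x)) ^ N \<le> (\<Sum>k. H k x)" by (intro LIMSEQ_le_const2) auto
    moreover have "norm (\<Sum>k. g k x) ^ N \<le> (\<Sum>k. norm (g k x)) ^ N"
      using summable_norm[OF gx] by (intro power_mono) auto
    ultimately show "norm (\<Sum>k. g k x) ^ N \<le> (\<Sum>k. H k x)" by linarith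
  qed
  have int_g: "integrable M (\<lambda>x. norm (\<Sum>k. g k x) ^ N)"
  proof (rule Bochner_Integration.integrable_bound[OF int_H])
    show "AE x in M. norm (norm (\<Sum>k. g k x) ^ N) \<le> norm (\<Sum>k. H k x)"
      using pw by eventually_elim simp
  qed measurable
  then show "(\<lambda>x. \<Sum>k. g k x) \<in> Lp M (real N)" by (simp add: Lp_norm_realpow(1)[OF N(1)])
  have "(\<integral>x. norm (\<Sum>k. g k x) ^ N \<partial>M) \<le> (\<integral>x. (\<Sum>k. H k x) \<partial>M)"
    by (rule integral_mono_AE[OF int_g int_H pw])
  also have "\<dots> \<le> (A / (1 - \<rho>)) ^ N"
  proof (rule sums_le)
    show "(\<integral>x. H k x \<partial>M) \<le> \<theta> k * (A / (1 - \<rho>)) ^ N" for k by (rule H_le)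
    show "(\<lambda>k. \<integral>x. H k x \<partial>M) sums (\<integral>x. (\<Sum>k. H k x) \<partial>M)"
      by (rule sums_integral[OF H_int AE_H H_sm])
    show "(\<lambda>k. \<theta> k * (A / (1 - \<rho>)) ^ N) sums ((A / (1 - \<rho>)) ^ N)"
      using sums_mult2[OF \<theta>_sums] by simp
  qed
  finally show "Lp_norm M (real N) (\<lambda>x. \<Sum>k. g k x) \<le> A / (1 - \<rho>)"
    using A \<rho> by (intro Lp_norm_realpow(2)[OF N(1)]) auto
qed

section \<open>Hypercontractivity\<close>

lemma frequency_finite_below:
  assumes "frequency \<Lambda>"
  shows "finite {x \<in> range \<Lambda>. x < T}"
proof -
  obtain N where N: "T < \<Lambda> N"
    using assms unfolding frequency_def bdd_above_def by (metis linorder_not_le rangeE)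
  have "n < N" if "\<Lambda> n < T" for n
    using assms N that strict_mono_less[of \<Lambda> n N] by (simp add: frequency_def)
  then have "{x \<in> range \<Lambda>. x < T} \<subseteq> \<Lambda> ` {..<N}" by auto
  then show ?thesis by (rule finite_subset) simp
qed

context dirichlet_flow
begin

lemma representers_mono:
  assumes "0 < r" "r \<le> s" "f \<in> representers \<Lambda> \<beta> \<mu> s a"
  shows "f \<in> representers \<Lambda> \<beta> \<mu> r a" "Lp_norm \<mu> r f \<le> Lp_norm \<mu> s f"
  using assms Lp_mono[OF assms(1,2)] by (auto simp: representers_def Hp_group_def)

lemma fourier_coeff_suminf:
  assumes \<gamma>: "character \<gamma>" and int: "\<And>k. integrable \<mu> (g k)"
    and AE_sm: "AE u in \<mu>. summable (\<lambda>k. norm (g k u))"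
    and sm: "summable (\<lambda>k. \<integral>u. norm (g k u) \<partial>\<mu>)"
  shows "(\<lambda>k. fourier_coeff \<mu> (g k) \<gamma>) sums fourier_coeff \<mu> (\<lambda>u. \<Sum>k. g k u) \<gamma>"
proof -
  have [measurable]: "(\<lambda>u. cnj (\<gamma> u)) \<in> borel_measurable \<mu>"
    using \<gamma> by (intro continuous_imp_measurable continuous_on_cnj) (simp add: character_def)
  have [measurable]: "g k \<in> borel_measurable \<mu>" for k using int by (rule borel_measurable_integrable)
  have norm_eq: "norm (g k u * cnj (\<gamma> u)) = norm (g k u)" for k u
    using \<gamma> by (simp add: character_def norm_mult)
  have "(\<lambda>k. \<integral>u. g k u * cnj (\<gamma> u) \<partial>\<mu>) sums (\<integral>u. (\<Sum>k. g k u * cnj (\<gamma> u)) \<partial>\<mu>)"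
  proof (rule sums_integral)
    show "integrable \<mu> (\<lambda>u. g k u * cnj (\<gamma> u))" for k
      by (rule Bochner_Integration.integrable_bound[OF int[of k]]) (simp_all add: norm_eq)
  qed (use AE_sm sm in \<open>simp_all only: norm_eq\<close>)
  also have "(\<integral>u. (\<Sum>k. g k u * cnj (\<gamma> u)) \<partial>\<mu>) = (\<integral>u. (\<Sum>k. g k u) * cnj (\<gamma> u) \<partial>\<mu>)"
  proof (rule integral_cong_AE)
    show "AE u in \<mu>. (\<Sum>k. g k u * cnj (\<gamma> u)) = (\<Sum>k. g k u) * cnj (\<gamma> u)"
      using AE_sm by eventually_elim (simp add: suminf_mult2 summable_norm_cancel)
  qed measurable
  finally show ?thesis by (simp add: fourier_coeff_def)
qed

lemma trig_sum_coefficient_off: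
  assumes X: "finite X" "X \<subseteq> spectrum" and \<gamma>: "character \<gamma>" "\<gamma> \<notin> h ` X"
  shows "fourier_coeff \<mu> (trig_sum X c) \<gamma> = 0"
proof -
  have cont: "continuous_on UNIV (\<lambda>u. h x u * cnj (\<gamma> u))" if "x \<in> X" for x
    using X \<gamma> that by (intro continuous_intros continuous_freq_char) (auto simp: character_def)
  have int: "integrable \<mu> (\<lambda>u. c x * (h x u * cnj (\<gamma> u)))" if "x \<in> X" for x
    by (intro integrable_mult_right integrable_continuous_bounded[where B = 1, OF cont[OF that]])
      (use X(2) \<gamma> that in \<open>simp add: norm_mult subset_iff character_def\<close>)
  have "fourier_coeff \<mu> (trig_sum X c) \<gamma> = (\<integral>u. (\<Sum>x\<in>X. c x * (h x u * cnj (\<gamma> u))) \<partial>\<mu>)"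
    unfolding fourier_coeff_def trig_sum_def by (simp add: sum_distrib_right mult.assoc)
  also have "\<dots> = (\<Sum>x\<in>X. \<integral>u. c x * (h x u * cnj (\<gamma> u)) \<partial>\<mu>)"
    by (rule Bochner_Integration.integral_sum[OF int])
  also have "\<dots> = 0"
  proof (rule sum.neutral, rule ballI)
    fix x assume "x \<in> X"
    then have "character (h x)" "h x \<noteq> \<gamma>" using X \<gamma> character_freq_char by auto
    then show "(\<integral>u. c x * (h x u * cnj (\<gamma> u)) \<partial>\<mu>) = 0" using character_orthogonal[OF _ \<gamma>(1)] by simp
  qed
  finally show ?thesis .
qed

text \<open>
  On frequencies in \<open>(k - 1, k + 1]\<close> the translation gains \<open>exp (- \<sigma> k)\<close> in \<open>L\<^sub>2\<close>, by Parseval. Passing from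
  \<open>L\<^sub>1\<close> to \<open>L\<^sub>2\<close> and from \<open>L\<^sub>2\<close> to higher exponents loses only factors \<open>exp (\<epsilon> k)\<close>, and a small \<open>\<epsilon>\<close> keeps half
  of the gain.
\<close>
lemma translated_windows_decay:
  assumes K: "thin_semigroup K" and \<sigma>: "0 < \<sigma>"
  shows "\<exists>C>0. \<forall>X c k. finite X \<longrightarrow> X \<subseteq> spectrum \<inter> K \<inter> {..real k + 1} \<longrightarrow>
    (\<forall>x\<in>X. x \<le> real k - 1 \<longrightarrow> c x = 0) \<longrightarrow>
    (\<integral>u. norm (trig_sum X (\<lambda>x. complex_of_real (exp (- x * \<sigma>)) * c x) u) ^ 2 ^ Suc m \<partial>\<mu>)
      \<le> (C * (\<integral>u. norm (trig_sum X c u) \<partial>\<mu>) * exp (- \<sigma> / 2) ^ k) ^ 2 ^ Suc m"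
proof -
  \<comment> \<open>The two moment estimates cost \<open>exp (\<epsilon> k)\<close> and \<open>exp (\<epsilon> k / 2)\<close>, up to constants, together \<open>exp (\<sigma> k / 2)\<close>.\<close>
  define \<epsilon> where "\<epsilon> = \<sigma> / 3"
  have \<epsilon>: "0 < \<epsilon>" using \<sigma> by (simp add: \<epsilon>_def)
  obtain C where C: "0 < C" and even: "\<And>T f. 0 \<le> T \<Longrightarrow> f \<in> low_polys K T \<Longrightarrow>
    (\<integral>u. norm (f u) ^ 2 ^ Suc m \<partial>\<mu>) \<le> C * exp (\<epsilon> * T) * (\<integral>u. norm (f u) ^ 2 \<partial>\<mu>) ^ 2 ^ m"
    using low_polys_even_moment[OF K \<epsilon>, of m] by blast
  obtain D where D: "0 < D" and second: "\<And>T f. f \<in> low_polys K T \<Longrightarrow>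
    (\<integral>u. norm (f u) ^ 2 \<partial>\<mu>) \<le> D * exp (\<epsilon> * T) * (\<integral>u. norm (f u) \<partial>\<mu>)\<^sup>2"
    using low_polys_second_moment[OF K \<epsilon>] by blast
  define A where "A = max 1 C * exp \<epsilon> * sqrt D * exp (\<epsilon> / 2) * exp \<sigma>"
  have "(\<integral>u. norm (trig_sum X (\<lambda>x. complex_of_real (exp (- x * \<sigma>)) * c x) u) ^ 2 ^ Suc m \<partial>\<mu>)
         \<le> (A * (\<integral>u. norm (trig_sum X c u) \<partial>\<mu>) * exp (- \<sigma> / 2) ^ k) ^ 2 ^ Suc m"
    if X: "finite X" "X \<subseteq> spectrum \<inter> K \<inter> {..real k + 1}"
      and c: "\<forall>x\<in>X. x \<le> real k - 1 \<longrightarrow> c x = 0" for X c k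
  proof -
    let ?f = "trig_sum X c" and ?g = "trig_sum X (\<lambda>x. complex_of_real (exp (- x * \<sigma>)) * c x)"
    define T where "T = real k + 1"
    define I where "I = (\<integral>u. norm (?f u) \<partial>\<mu>)"
    define E where "E = exp (- \<sigma> * (real k - 1))"
    have I: "0 \<le> I" unfolding I_def by (rule Bochner_Integration.integral_nonneg) simp
    have Xs: "X \<subseteq> spectrum" using X by auto
    have low: "?f \<in> low_polys K T" "?g \<in> low_polys K T"
      using X by (auto simp: low_polys_def trig_polys_def T_def)
    have "(\<integral>u. norm (?g u) ^ 2 \<partial>\<mu>) = (\<Sum>x\<in>X. norm (complex_of_real (exp (- x * \<sigma>)) * c x) ^ 2)"
      by (rule parseval[OF X(1) Xs])
    also have "\<dots> \<le> (\<Sum>x\<in>X. E\<^sup>2 * norm (c x) ^ 2)"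
    proof (rule sum_mono)
      fix x assume x: "x \<in> X"
      show "norm (complex_of_real (exp (- x * \<sigma>)) * c x) ^ 2 \<le> E\<^sup>2 * norm (c x) ^ 2"
      proof (cases "x \<le> real k - 1")
        case True
        then show ?thesis using c x by simp
      next
        case False
        then have "- x * \<sigma> \<le> - \<sigma> * (real k - 1)" using \<sigma> by (simp add: mult.commute mult_left_mono)
        then have "exp (- x * \<sigma>) \<le> E" by (simp add: E_def)
        then have "exp (- x * \<sigma>) * norm (c x) \<le> E * norm (c x)" by (rule mult_right_mono) simp
        then have "(exp (- x * \<sigma>) * norm (c x))\<^sup>2 \<le> (E * norm (c x))\<^sup>2" by (rule power_mono) simp
        then show ?thesis by (simp add: norm_mult power_mult_distrib)
      qed
    qed
    also have "\<dots> = E\<^sup>2 * (\<integral>u. norm (?f u) ^ 2 \<partial>\<mu>)"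
      by (simp add: parseval[OF X(1) Xs] sum_distrib_left)
    also have "\<dots> \<le> E\<^sup>2 * (D * exp (\<epsilon> * T) * I\<^sup>2)"
      unfolding I_def by (rule mult_left_mono[OF second[OF low(1)]]) simp
    also have "\<dots> = (E * sqrt D * exp (\<epsilon> * T / 2) * I)\<^sup>2"
    proof -
      have "exp (\<epsilon> * T) = (exp (\<epsilon> * T / 2))\<^sup>2" by (simp flip: exp_double)
      then show ?thesis using D by (simp add: power_mult_distrib)
    qed
    finally have g2: "(\<integral>u. norm (?g u) ^ 2 \<partial>\<mu>) \<le> (E * sqrt D * exp (\<epsilon> * T / 2) * I)\<^sup>2" .
    have "(\<integral>u. norm (?g u) ^ 2 ^ Suc m \<partial>\<mu>) \<le> C * exp (\<epsilon> * T) * (\<integral>u. norm (?g u) ^ 2 \<partial>\<mu>) ^ 2 ^ m"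
      by (rule even[OF _ low(2)]) (simp add: T_def)
    also have "\<dots> \<le> C * exp (\<epsilon> * T) * ((E * sqrt D * exp (\<epsilon> * T / 2) * I)\<^sup>2) ^ 2 ^ m"
      using C g2 by (intro mult_left_mono power_mono) auto
    also have "((E * sqrt D * exp (\<epsilon> * T / 2) * I)\<^sup>2) ^ 2 ^ m = (E * sqrt D * exp (\<epsilon> * T / 2) * I) ^ 2 ^ Suc m"
      by (simp add: power_mult[symmetric])
    also have "C * exp (\<epsilon> * T) * \<dots> \<le> (max 1 C * exp (\<epsilon> * T)) ^ 2 ^ Suc m * \<dots>"
    proof (rule mult_right_mono)
      have "1 \<le> exp (\<epsilon> * T)" using \<epsilon> by (simp add: T_def)
      then have "1 * 1 \<le> max 1 C * exp (\<epsilon> * T)" by (intro mult_mono) auto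
      then have "max 1 C * exp (\<epsilon> * T) \<le> (max 1 C * exp (\<epsilon> * T)) ^ 2 ^ Suc m"
        by (intro self_le_power) auto
      moreover have "C * exp (\<epsilon> * T) \<le> max 1 C * exp (\<epsilon> * T)" by simp
      ultimately show "C * exp (\<epsilon> * T) \<le> (max 1 C * exp (\<epsilon> * T)) ^ 2 ^ Suc m" by linarith
      show "0 \<le> (E * sqrt D * exp (\<epsilon> * T / 2) * I) ^ 2 ^ Suc m"
        using I D by (simp add: E_def)
    qed
    also have "\<dots> = (max 1 C * exp (\<epsilon> * T) * (E * sqrt D * exp (\<epsilon> * T / 2) * I)) ^ 2 ^ Suc m"
      by (rule power_mult_distrib[symmetric])
    also have "max 1 C * exp (\<epsilon> * T) * (E * sqrt D * exp (\<epsilon> * T / 2) * I)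
        = max 1 C * sqrt D * I * (exp (\<epsilon> * T) * E * exp (\<epsilon> * T / 2))"
      by (simp add: mult_ac)
    also have "exp (\<epsilon> * T) * E * exp (\<epsilon> * T / 2) = exp \<epsilon> * exp (\<epsilon> / 2) * exp \<sigma> * exp (- \<sigma> / 2) ^ k"
      unfolding E_def T_def \<epsilon>_def exp_of_nat_mult[symmetric] exp_add[symmetric]
      by (simp add: field_simps)
    also have "max 1 C * sqrt D * I * (exp \<epsilon> * exp (\<epsilon> / 2) * exp \<sigma> * exp (- \<sigma> / 2) ^ k)
        = A * I * exp (- \<sigma> / 2) ^ k" by (simp add: A_def mult_ac)
    finally show ?thesis by (simp add: I_def)
  qed
  moreover have "0 < A" using D by (simp add: A_def)
  ultimately show ?thesis by blast
qed

text \<open>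
  The representing function is the sum of the translated windows of \<open>f\<close>. Since the windows add up to
  \<open>1\<close> at each frequency, its Fourier coefficients are those of the translated series.
\<close>
lemma translation_representer:
  assumes K: "thin_semigroup K" and freq: "frequency \<Lambda>"
    and \<Lambda>: "range \<Lambda> \<subseteq> spectrum \<inter> K" and \<sigma>: "0 < \<sigma>"
  obtains C where "0 < C" and
    "\<And>f a. f \<in> representers \<Lambda> \<beta> \<mu> 1 a \<Longrightarrow>
      \<exists>g \<in> representers \<Lambda> \<beta> \<mu> (real (2 ^ Suc m)) (translation \<Lambda> \<sigma> a).
        Lp_norm \<mu> (real (2 ^ Suc m)) g \<le> C * Lp_norm \<mu> 1 f"
proof -
  let ?N = "2 ^ Suc m :: nat"
  define \<rho> where "\<rho> = exp (- \<sigma> / 2)"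
  have \<rho>: "0 < \<rho>" "\<rho> < 1" using \<sigma> by (simp_all add: \<rho>_def)
  obtain C where C: "0 < C" and decay:
    "\<forall>X c k. finite X \<longrightarrow> X \<subseteq> spectrum \<inter> K \<inter> {..real k + 1} \<longrightarrow>
       (\<forall>x\<in>X. x \<le> real k - 1 \<longrightarrow> c x = 0) \<longrightarrow>
       (\<integral>u. norm (trig_sum X (\<lambda>x. complex_of_real (exp (- x * \<sigma>)) * c x) u) ^ ?N \<partial>\<mu>)
         \<le> (C * (\<integral>u. norm (trig_sum X c u) \<partial>\<mu>) * \<rho> ^ k) ^ ?N"
    using translated_windows_decay[OF K \<sigma>, of m] unfolding \<rho>_def by blast
  have main: "\<exists>g \<in> representers \<Lambda> \<beta> \<mu> (real ?N) (translation \<Lambda> \<sigma> a).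
        Lp_norm \<mu> (real ?N) g \<le> C / (1 - \<rho>) * Lp_norm \<mu> 1 f"
    if f: "f \<in> representers \<Lambda> \<beta> \<mu> 1 a" for f a
  proof -
    have int_f: "integrable \<mu> f"
      using f integrable_norm_iff[of f \<mu>] by (simp add: representers_def Hp_group_def Lp_def)
    have a: "a n = fourier_coeff \<mu> f (h (\<Lambda> n))" for n
      using f by (simp add: representers_def)
    have off: "fourier_coeff \<mu> f \<gamma> = 0" if "character \<gamma>" "\<gamma> \<notin> range (\<lambda>n. h (\<Lambda> n))" for \<gamma>
      using f that by (simp add: representers_def Hp_group_def)
    define X where "X k = {x \<in> range \<Lambda>. x < real k + 1}" for k
    have X: "finite (X k)" "X k \<subseteq> spectrum \<inter> K \<inter> {..real k + 1}" "X k \<subseteq> spectrum" for k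
      using frequency_finite_below[OF freq] \<Lambda> by (auto simp: X_def)
    define w where "w k x = tent (x - real k) * fourier_coeff \<mu> f (h x)" for k x
    define g where "g k = trig_sum (X k) (\<lambda>x. exp (- x * \<sigma>) * w k x)" for k
    define I where "I = (\<integral>u. norm (f u) \<partial>\<mu>)"
    have I: "0 \<le> I" unfolding I_def by (rule Bochner_Integration.integral_nonneg) simp
    have window: "(\<integral>u. norm (trig_sum (X k) (w k) u) \<partial>\<mu>) \<le> I" for k
      unfolding w_def I_def
    proof (rule window_L1_contraction[OF int_f X(1,3)])
      fix y assume y: "y \<in> spectrum" "y \<notin> X k"
      show "tent (y - real k) * fourier_coeff \<mu> f (h y) = 0"
      proof (cases "y \<in> range \<Lambda>")
        case True
        then show ?thesis using y by (simp add: X_def tent_def)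
      next
        case False
        then have "h y \<notin> range (\<lambda>n. h (\<Lambda> n))" using freq_char_inj[OF y(1)] \<Lambda> by blast
        then show ?thesis using off[OF character_freq_char[OF y(1)]] by simp
      qed
    qed
    have g_meas: "g k \<in> borel_measurable \<mu>" for k unfolding g_def by (rule trig_sum_measurable[OF X(3)])
    have g_Lp: "g k \<in> Lp \<mu> (real ?N)" for k
      using g_meas trig_sum_integrable_power[OF X(3)] by (subst Lp_norm_realpow(1)) (auto simp: g_def)
    have g_le: "(\<integral>u. norm (g k u) ^ ?N \<partial>\<mu>) \<le> (C * I * \<rho> ^ k) ^ ?N" for k
    proof -
      have "(\<integral>u. norm (g k u) ^ ?N \<partial>\<mu>) \<le> (C * (\<integral>u. norm (trig_sum (X k) (w k) u) \<partial>\<mu>) * \<rho> ^ k) ^ ?N"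
        unfolding g_def by (rule decay[rule_format, OF X(1,2)]) (simp add: w_def tent_def)
      also have "\<dots> \<le> (C * I * \<rho> ^ k) ^ ?N"
        using window C \<rho>
        by (intro power_mono mult_right_mono mult_left_mono mult_nonneg_nonneg
            Bochner_Integration.integral_nonneg) auto
      finally show ?thesis .
    qed
    have "0 \<le> C * I" using C I by simp
    note series = geometric_series_Lp[OF g_Lp this \<rho> g_le]
    define G where "G u = (\<Sum>k. g k u)" for u
    have coeffs: "(\<lambda>k. fourier_coeff \<mu> (g k) \<gamma>) sums fourier_coeff \<mu> G \<gamma>" if "character \<gamma>" for \<gamma>
      unfolding G_def by (rule fourier_coeff_suminf[OF that series(1-3)])
    have "G \<in> Lp \<mu> (real ?N)" unfolding G_def by (rule series(4))
    moreover have "fourier_coeff \<mu> G \<gamma> = 0" if "character \<gamma>" "\<gamma> \<notin> range (\<lambda>n. h (\<Lambda> n))" for \<gamma>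
    proof -
      have "\<gamma> \<notin> h ` X k" for k using that(2) by (auto simp: X_def)
      then have "fourier_coeff \<mu> (g k) \<gamma> = 0" for k
        unfolding g_def using X that(1) by (intro trig_sum_coefficient_off) auto
      then have "(\<lambda>k. 0) sums fourier_coeff \<mu> G \<gamma>" using coeffs[OF that(1)] by simp
      from this sums_zero show ?thesis by (rule sums_unique2)
    qed
    moreover have "translation \<Lambda> \<sigma> a n = fourier_coeff \<mu> G (h (\<Lambda> n))" for n
    proof -
      have sp: "\<Lambda> n \<in> spectrum" using \<Lambda> by auto
      have "fourier_coeff \<mu> (g k) (h (\<Lambda> n)) = tent (\<Lambda> n - real k) * translation \<Lambda> \<sigma> a n" for k
        unfolding g_def using trig_sum_coefficient[OF X(1,3) sp]
        by (auto simp: w_def translation_def a X_def tent_def)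
      moreover have "(\<lambda>k. complex_of_real (tent (\<Lambda> n - real k)) * translation \<Lambda> \<sigma> a n) sums (complex_of_real 1 * translation \<Lambda> \<sigma> a n)"
        using freq by (intro sums_mult2 sums_of_real tent_partition_of_unity) (simp add: frequency_def)
      ultimately show ?thesis
        using sums_unique2[OF coeffs[OF character_freq_char[OF sp]]] by simp
    qed
    ultimately have "G \<in> representers \<Lambda> \<beta> \<mu> (real ?N) (translation \<Lambda> \<sigma> a)"
      by (simp add: representers_def Hp_group_def)
    moreover have "Lp_norm \<mu> (real ?N) G \<le> C / (1 - \<rho>) * Lp_norm \<mu> 1 f"
      using series(5) I by (simp add: G_def[abs_def] Lp_norm_def I_def)
    ultimately show ?thesis by blast
  qed
  have "0 < C / (1 - \<rho>)" using C \<rho> by simp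
  then show thesis using main by (rule that)
qed

text \<open>
  On a probability space the \<open>L\<^sub>p\<close> norms increase with \<open>p\<close>, so it suffices to go from \<open>L\<^sub>1\<close> to an exponent
  that is a power of two and at least \<open>q\<close>.
\<close>
lemma hypercontractive_if_thin:
  assumes K: "thin_semigroup K" and freq: "frequency \<Lambda>" and \<Lambda>: "range \<Lambda> \<subseteq> spectrum \<inter> K"
  shows "hypercontractive \<beta> \<mu> \<Lambda>"
  unfolding hypercontractive_def
proof (intro allI impI)
  fix \<sigma> p q :: real assume \<sigma>: "0 < \<sigma>" and "1 \<le> p \<and> p \<le> q"
  then have pq: "1 \<le> p" "0 < q" by auto
  obtain m where "q < 2 ^ m" using real_arch_pow[of 2 q] by auto
  then have m: "q \<le> real (2 ^ Suc m)" by (rule order_trans[OF less_imp_le]) simp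
  obtain C where C: "0 < C" and ex: "\<And>f a. f \<in> representers \<Lambda> \<beta> \<mu> 1 a \<Longrightarrow>
      \<exists>g \<in> representers \<Lambda> \<beta> \<mu> (real (2 ^ Suc m)) (translation \<Lambda> \<sigma> a).
        Lp_norm \<mu> (real (2 ^ Suc m)) g \<le> C * Lp_norm \<mu> 1 f"
    by (rule translation_representer[OF K freq \<Lambda> \<sigma>, of m], rule that)
  have main: "\<exists>g \<in> representers \<Lambda> \<beta> \<mu> q (translation \<Lambda> \<sigma> a). Lp_norm \<mu> q g \<le> C * Lp_norm \<mu> p f"
    if f: "f \<in> representers \<Lambda> \<beta> \<mu> p a" for f a
  proof -
    have f1: "f \<in> representers \<Lambda> \<beta> \<mu> 1 a" "Lp_norm \<mu> 1 f \<le> Lp_norm \<mu> p f"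
      using representers_mono[OF _ pq(1) f] by simp_all
    then obtain g where g: "g \<in> representers \<Lambda> \<beta> \<mu> (real (2 ^ Suc m)) (translation \<Lambda> \<sigma> a)"
      "Lp_norm \<mu> (real (2 ^ Suc m)) g \<le> C * Lp_norm \<mu> 1 f" using ex by blast
    have "Lp_norm \<mu> q g \<le> C * Lp_norm \<mu> 1 f"
      using representers_mono(2)[OF pq(2) m g(1)] g(2) by simp
    also have "\<dots> \<le> C * Lp_norm \<mu> p f" using C f1(2) by simp
    finally show ?thesis using representers_mono(1)[OF pq(2) m g(1)] by blast
  qed
  have "Hp_norm \<Lambda> \<beta> \<mu> q (translation \<Lambda> \<sigma> a) \<le> C * Hp_norm \<Lambda> \<beta> \<mu> p a"
    if "a \<in> Hp \<Lambda> \<beta> \<mu> p" for a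
  proof -
    have "Hp_norm \<Lambda> \<beta> \<mu> q (translation \<Lambda> \<sigma> a) / C \<le> Hp_norm \<Lambda> \<beta> \<mu> p a"
      unfolding Hp_norm_def[of _ _ _ p]
    proof (rule cINF_greatest)
      show "representers \<Lambda> \<beta> \<mu> p a \<noteq> {}" using that by (simp add: Hp_def)
      fix f assume "f \<in> representers \<Lambda> \<beta> \<mu> p a"
      from main[OF this] obtain g where g: "g \<in> representers \<Lambda> \<beta> \<mu> q (translation \<Lambda> \<sigma> a)"
        "Lp_norm \<mu> q g \<le> C * Lp_norm \<mu> p f" by blast
      have "bdd_below (Lp_norm \<mu> q ` representers \<Lambda> \<beta> \<mu> q (translation \<Lambda> \<sigma> a))"
        by (rule bdd_belowI[of _ 0]) (auto simp: Lp_norm_def)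
      then have "Hp_norm \<Lambda> \<beta> \<mu> q (translation \<Lambda> \<sigma> a) \<le> Lp_norm \<mu> q g"
        unfolding Hp_norm_def by (rule cINF_lower[OF _ g(1)])
      then show "Hp_norm \<Lambda> \<beta> \<mu> q (translation \<Lambda> \<sigma> a) / C \<le> Lp_norm \<mu> p f"
        using g(2) C by (simp add: divide_le_eq mult.commute)
    qed
    then show ?thesis using C by (simp add: divide_le_eq mult.commute)
  qed
  moreover have "translation \<Lambda> \<sigma> ` Hp \<Lambda> \<beta> \<mu> p \<subseteq> Hp \<Lambda> \<beta> \<mu> q"
    using main by (fastforce simp: Hp_def)
  ultimately show "translation \<Lambda> \<sigma> ` Hp \<Lambda> \<beta> \<mu> p \<subseteq> Hp \<Lambda> \<beta> \<mu> q \<and>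
      (\<exists>C. \<forall>a\<in>Hp \<Lambda> \<beta> \<mu> p. Hp_norm \<Lambda> \<beta> \<mu> q (translation \<Lambda> \<sigma> a) \<le> C * Hp_norm \<Lambda> \<beta> \<mu> p a)"
    by blast
qed

end

theorem theorem5p16:
  fixes \<Lambda> :: "nat \<Rightarrow> real"
    and R :: "nat \<Rightarrow> nat \<Rightarrow> rat" and L :: enat and b :: "nat \<Rightarrow> real"
    and \<beta> :: "real \<Rightarrow> 'g::{topological_ab_group_add, t2_space}" and \<mu> :: "'g measure"
  assumes "frequency \<Lambda>"
    and "decomposition \<Lambda> R L b" and "natural_type R"
    and "\<And>j. j \<in> indices L \<Longrightarrow> b j > 0"
    and "L = \<infinity> \<Longrightarrow> filterlim b at_top sequentially"
    and "dirichlet_group \<Lambda> \<beta>" and "haar_measure \<mu>"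
  shows "hypercontractive \<beta> \<mu> \<Lambda>"
proof -
  interpret dirichlet_flow \<beta> \<mu>
    by unfold_locales (use assms in \<open>auto simp: dirichlet_group_def\<close>)
  have "\<Lambda> n \<in> spectrum" for n
    using assms(6) by (simp add: dirichlet_group_def spectrum_def cis_conv_exp)
  moreover have "\<Lambda> n \<in> nat_cone (indices L) b" for n
    by (rule decomposition_in_nat_cone[OF assms(2,3)])
  moreover have "thin_semigroup (nat_cone (indices L) b)"
    using assms(2,4,5) by (intro thin_nat_cone) (auto simp: decomposition_def)
  ultimately show ?thesis
    using assms(1) by (intro hypercontractive_if_thin[of "nat_cone (indices L) b"]) auto
qed

end
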